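(* Fix $\lambda>0$. Let $K\subset\mathrm{SO}(5)$ be a connected closed subgroup and suppose some $K$-orbit $L=K\cdot p\subset\Lambda^2_-S^4$ is a 4-dimensional coassociative submanifold of $(\Lambda^2_-S^4,\varphi_\lambda)$. Then $L$ is the zero section $S^4\subset\Lambda^2_-S^4$. Equivalently, every homogeneous coassociative submanifold of $(\Lambda^2_-S^4,\varphi_\lambda)$ is congruent under $\mathrm{SO}(5)$ to the zero section.
   Context: Let $S^4=\{x={}^t(x_1,\dots,x_5)\in\mathbb R^5:|x|=1\}$ with the round metric and let $\pi:\Lambda^2_-S^4\to S^4$ be the rank-3 bundle of anti-self-dual 2-forms. On $S^4\setminus\{x_5=\pm1\}$ use the oriented orthonormal frame $e_1=\frac{1}{\sqrt{1-x_5^2}}{}^t(-x_2,x_1,-x_4,x_3,0)$, $e_2=\frac{1}{\sqrt{1-x_5^2}}{}^t(-x_3,x_4,x_1,-x_2,0)$, $e_3=\frac{1}{\sqrt{1-x_5^2}}{}^t(-x_4,-x_3,x_2,x_1,0)$, $e_4=\frac{1}{\sqrt{1-x_5^2}}{}^t(-x_1x_5,-x_2x_5,-x_3x_5,-x_4x_5,1-x_5^2)$ with dual coframe $e^1,\dots,e^4$, and set $\omega_1=e^{12}-e^{34}$, $\omega_2=e^{13}-e^{42}$, $\omega_3=e^{14}-e^{23}$ ($e^{ij}=e^i\wedge e^j$), a local frame of $\Lambda^2_-S^4$. The point $\sum_i a_i\omega_i|_x$ is written $(x,{}^t(a_1,a_2,a_3))$; $r^2=a_1^2+a_2^2+a_3^2$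 is the squared fiber norm (globally defined). Write $\nabla\omega_i=\sum_j\gamma_{ij}\otimes\omega_j$ for the connection induced by the Levi-Civita connection and $b_i=da_i+\sum_j a_j\pi^*\gamma_{ji}$. For $\lambda>0$ the Bryant–Salamon 3-form is $\varphi_\lambda=2s_\lambda\sum_{i=1}^3 b_i\wedge\pi^*\omega_i+s_\lambda^{-3}b_1\wedge b_2\wedge b_3$ with $s_\lambda=(\lambda+r^2)^{1/4}$ (equivalently $2s_\lambda d\tau+s_\lambda^{-3}\mathrm{vol}_{\mathcal V}$, $\tau$ the tautological 2-form, $\mathrm{vol}_{\mathcal V}$ the vertical volume form; it is globally defined). It is a torsion-free $G_2$-structure with a complete metric of holonomy $G_2$. A 4-dimensional submanifold $L$ is coassociative iff $\varphi_\lambda|_{TL}=0$. $\mathrm{SO}(5)$ acts on $S^4$ linearly and on $\Lambda^2_-S^4$ by the induced action on 2-forms ($g\cdot\omega=(g^{-1})^*\omega$); this action preserves $\varphi_\lambda$, and $\mathrm{SO}(5)$ is the automorphism group of $(\Lambda^2_-S^4,\varphi_\lambda)$. The zero section is identified with $S^4$. A homogeneous coassociative submanifold is one that is an orbit of a closed subgroup of the automorphism group. *)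

theory Defs
  imports "HOL-Analysis.Analysis"
begin

text \<open>Model of the total space of the bundle of anti-self-dual 2-forms on S^4.
  A 2-form on T_x S^4 = x-perp (a subspace of R^5) is represented by a skew
  5x5 real matrix A with A x = 0, acting as omega(v,w) = v . (A w).
  A point of the total space is a pair (x, A).\<close>

type_synonym pt5 = "real^5"
type_synonym mat5 = "real^5^5"

definition frob :: "mat5 \<Rightarrow> mat5 \<Rightarrow> real" where
  "frob A B = (\<Sum>i\<in>UNIV. \<Sum>j\<in>UNIV. A$i$j * B$i$j)"

definition proj_tan :: "pt5 \<Rightarrow> mat5" where
  "proj_tan x = mat 1 - (\<chi> i j. x$i * x$j)"

definition det5 :: "pt5 \<Rightarrow> pt5 \<Rightarrow> pt5 \<Rightarrow> pt5 \<Rightarrow> pt5 \<Rightarrow> real" where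
  "det5 a b c d e = det (\<chi> r. if r = 1 then a else if r = 2 then b else if r = 3 then c
                              else if r = 4 then d else (e :: pt5))"

text \<open>Hodge star on 2-forms of T_x S^4, with the orientation for which
  (v1,..,v4) is oriented iff det(x,v1,..,v4) > 0 (this is the orientation of
  the frame e1..e4 of the paper).\<close>
definition hodge :: "pt5 \<Rightarrow> mat5 \<Rightarrow> mat5" where
  "hodge x M = (\<chi> j k. (1/2) * (\<Sum>m\<in>UNIV. \<Sum>n\<in>UNIV.
       M$m$n * det5 x (axis j 1) (axis k 1) (axis m 1) (axis n 1)))"

definition ASD_bundle :: "(pt5 \<times> mat5) set" where
  "ASD_bundle = {(x, A). norm x = 1 \<and> transpose A = - A \<and> A *v x = 0 \<and> hodge x A = - A}"

definition zero_section :: "(pt5 \<times> mat5) set" where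
  "zero_section = {(x, 0) | x. norm x = 1}"

text \<open>Oriented vertical volume form b1 ^ b2 ^ b3 evaluated on three vertical vectors
  (fibre coordinates w.r.t. the paper's frame omega_1,omega_2,omega_3 are
  a_i = frob B omega_i / 4; the determinant of these coordinates equals the
  expression below).\<close>
definition vol_V :: "mat5 \<Rightarrow> mat5 \<Rightarrow> mat5 \<Rightarrow> real" where
  "vol_V B1 B2 B3 = frob B1 (B2 ** B3 - B3 ** B2) / 8"

text \<open>The Bryant--Salamon 3-form phi_lambda at the point (x,A), evaluated on three
  tangent vectors (v_i, C_i) in R^5 x R^(5x5).  The vertical (connection) part of
  (v,C) is the covariant derivative P C P (P = proj_tan x), whose fibre coordinates
  are the b_i of the paper; pi_* (v,C) = v.  Wedge convention:
  (b ^ w)(u1,u2,u3) = b(u1) w(u2,u3) - b(u2) w(u1,u3) + b(u3) w(u1,u2).\<close>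
definition phi :: "real \<Rightarrow> pt5 \<times> mat5 \<Rightarrow> pt5 \<times> mat5 \<Rightarrow> pt5 \<times> mat5 \<Rightarrow> pt5 \<times> mat5 \<Rightarrow> real" where
  "phi lam p u1 u2 u3 =
     (let x = fst p; A = snd p; P = proj_tan x;
          v1 = fst u1; v2 = fst u2; v3 = fst u3;
          B1 = P ** snd u1 ** P; B2 = P ** snd u2 ** P; B3 = P ** snd u3 ** P;
          s = (lam + frob A A / 4) powr (1/4)
      in 2 * s * (v2 \<bullet> (B1 *v v3) - v1 \<bullet> (B2 *v v3) + v1 \<bullet> (B3 *v v2))
         + s powr (-3) * vol_V B1 B2 B3)"

definition SO5 :: "mat5 set" where
  "SO5 = {g. orthogonal_matrix g \<and> det g = 1}"

text \<open>Induced action on 2-forms: g . omega = (g^-1)^* omega, i.e. A \<mapsto> g A g^T.\<close>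
definition act :: "mat5 \<Rightarrow> pt5 \<times> mat5 \<Rightarrow> pt5 \<times> mat5" where
  "act g p = (g *v fst p, g ** snd p ** transpose g)"

definition closed_connected_subgroup_SO5 :: "mat5 set \<Rightarrow> bool" where
  "closed_connected_subgroup_SO5 K \<longleftrightarrow>
     K \<subseteq> SO5 \<and> mat 1 \<in> K \<and> (\<forall>g\<in>K. \<forall>h\<in>K. g ** h \<in> K) \<and>
     (\<forall>g\<in>K. matrix_inv g \<in> K) \<and> closed K \<and> connected K"

definition orbit :: "mat5 set \<Rightarrow> pt5 \<times> mat5 \<Rightarrow> (pt5 \<times> mat5) set" where
  "orbit K p = (\<lambda>g. act g p) ` K"

text \<open>Tangent vectors of a subset S at q: velocities of differentiable curves in S
  through q.  For an embedded submanifold this is its tangent space.\<close>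
definition tangent_vecs :: "(pt5 \<times> mat5) set \<Rightarrow> pt5 \<times> mat5 \<Rightarrow> (pt5 \<times> mat5) set" where
  "tangent_vecs S q = {v. \<exists>c. (\<forall>t. c t \<in> S) \<and> c 0 = q \<and> (c has_vector_derivative v) (at 0)}"

definition coassociative :: "real \<Rightarrow> (pt5 \<times> mat5) set \<Rightarrow> bool" where
  "coassociative lam L \<longleftrightarrow>
     (\<forall>q\<in>L. \<forall>u1\<in>tangent_vecs L q. \<forall>u2\<in>tangent_vecs L q. \<forall>u3\<in>tangent_vecs L q.
        phi lam q u1 u2 u3 = 0)"

end

theory Submission
  imports Defs
begin

text \<open>The squared fibre norm is constant on an orbit.  If it is positive, the orbit lies in a sphere
  bundle (the twistor space), whose tangent space at \<open>p\<close> is a complex 3-space in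
  which \<open>\<phi>\<^sub>\<lambda>\<close> restricts to a multiple of the real part of a complex volume form
  \<open>\<Omega>\<close>.  A real 4-space on which \<open>Re \<Omega>\<close> vanishes is a complex plane, so
  \<open>Im \<Omega>\<close> vanishes on it too.  But for this (nearly Kaehler) almost complex structure
  \<open>d (Im \<Omega>)\<close> is non-zero on every complex plane; on an orbit this derivative is expressed by
  brackets in the Lie algebra of \<open>K\<close>, which gives a contradiction.  Hence the orbit lies
  in the zero section, and a 4-dimensional orbit there is everything: at a point of the orbit closest to a
  given point of the sphere, the latter is orthogonal to the tangent space.\<close>

text \<open>Coassociativity and dimension are stated through \<open>tangent_vecs\<close>, velocities
  of curves differentiable at a single parameter. To use coassociativity it is enough that each
  \<open>inf_act X p\<close> is such a velocity; the dimension hypothesis needs the converse, and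
  this is the analytic half of the proof. Powers of group elements near the identity, compactness
  and a quadratic error bound take the place of the exponential map. The exterior derivative is
  replaced by a bracket computation. On skew matrices the kernel of \<open>tancoord\<close> is the
  stabiliser u(2) of a model point, and modulo u(2) the bracket is complex linear in one argument
  apart from one conjugate-bilinear term. A combination over u, iu, w, iw isolates that term; the
  conjugation turns its pairing with the minors of u, w into a sum of squared moduli. All
  computations take place at \<open>(axis 5 1, \<rho> *\<^sub>R std_J)\<close>. This point is
  self-dual for \<open>hodge\<close>, so it is reached only by orthogonal matrices of determinant
  -1; that is harmless because \<open>phi\<close> is built from inner products and traces
  alone.\<close>

lemma exhaust_5: "x = 1 \<or> x = 2 \<or> x = 3 \<or> x = 4 \<or> x = 5" for x :: 5
proof (induct x)
  case (of_int z)
  then have "z = 0 \<or> z = 1 \<or> z = 2 \<or> z = 3 \<or> z = 4" by fastforce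
  then show ?case by auto
qed

lemma UNIV_5: "UNIV = {1, 2, 3, 4, 5::5}"
  using exhaust_5 by auto

lemma forall_5: "(\<forall>i::5. P i) \<longleftrightarrow> P 1 \<and> P 2 \<and> P 3 \<and> P 4 \<and> P 5"
  using exhaust_5 by (smt (verit))

lemma sum_5: "sum f (UNIV::5 set) = f 1 + f 2 + f 3 + f 4 + f 5"
  unfolding UNIV_5 by (simp add: ac_simps)

section \<open>Subalgebras with complex tangent plane\<close>

definition lie_bracket :: "real^'n^'n \<Rightarrow> real^'n^'n \<Rightarrow> real^'n^'n" where
  "lie_bracket X Y = X ** Y - Y ** X"

text \<open>Complex coordinates on the tangent space of the sphere bundle at the point with base point
  \<open>e\<^sub>5\<close> and fibre coordinate a multiple of \<open>J\<close>, where \<open>J e\<^sub>1 = e\<^sub>2\<close> and \<open>J e\<^sub>3 = e\<^sub>4\<close>: two horizontal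
  coordinates and, from the part of \<open>X\<close> anticommuting with \<open>J\<close>, one vertical coordinate.  The vertical
  coordinate carries the conjugate of the integrable structure.\<close>

definition tancoord :: "mat5 \<Rightarrow> complex \<times> complex \<times> complex" where
  "tancoord X = (Complex (X$1$5) (X$2$5), Complex (X$3$5) (X$4$5),
     Complex (X$1$4 + X$2$3) (X$1$3 - X$2$4))"

definition det3 :: "complex \<times> complex \<times> complex \<Rightarrow> complex \<times> complex \<times> complex
    \<Rightarrow> complex \<times> complex \<times> complex \<Rightarrow> complex" where
  "det3 = (\<lambda>(a1, a2, a3) (b1, b2, b3) (c1, c2, c3).
     a1 * (b2 * c3 - b3 * c2) + a2 * (b3 * c1 - b1 * c3) + a3 * (b1 * c2 - b2 * c1))"

definition iscale :: "complex \<times> complex \<times> complex \<Rightarrow> complex \<times> complex \<times> complex" where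
  "iscale = (\<lambda>(a, b, c). (\<i> * a, \<i> * b, \<i> * c))"

lemma skew_entry: "transpose X = - X \<Longrightarrow> X$j$i = - X$i$j" for X :: mat5
  by (drule arg_cong[where f="\<lambda>M. M$i$j"]) (simp add: transpose_def)

lemma skew_diag: "transpose X = - X \<Longrightarrow> X$i$i = 0" for X :: mat5
  using skew_entry[of X i i] by simp

lemma skew_entries:
  assumes "transpose (X::mat5) = - X"
  shows "X$1$1 = 0" "X$2$2 = 0" "X$3$3 = 0" "X$4$4 = 0" "X$5$5 = 0"
    "X$2$1 = - X$1$2" "X$3$1 = - X$1$3" "X$4$1 = - X$1$4" "X$5$1 = - X$1$5"
    "X$3$2 = - X$2$3" "X$4$2 = - X$2$4" "X$5$2 = - X$2$5"
    "X$4$3 = - X$3$4" "X$5$3 = - X$3$5" "X$5$4 = - X$4$5"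
  by (rule skew_diag[OF assms] skew_entry[OF assms])+

text \<open>Up to terms that are complex linear in one of the two tangent vectors, the bracket is the
  conjugate-bilinear map \<open>torsion \<circ> ccross3\<close>.\<close>

definition isot :: "mat5 \<Rightarrow> complex \<times> complex \<times> complex \<Rightarrow> complex \<times> complex \<times> complex" where
  "isot X = (\<lambda>(z1, z2, z3).
     let e = Complex (X$1$3 + X$2$4) (X$1$4 - X$2$3) / 2
     in (cnj e * z2 - \<i> * X$1$2 * z1, - e * z1 - \<i> * X$3$4 * z2, \<i> * (X$1$2 + X$3$4) * z3))"

definition ccross3 :: "complex \<times> complex \<times> complex \<Rightarrow> complex \<times> complex \<times> complex
    \<Rightarrow> complex \<times> complex \<times> complex" where
  "ccross3 = (\<lambda>(a1, a2, a3) (b1, b2, b3). (a2 * b3 - a3 * b2, a3 * b1 - a1 * b3, a1 * b2 - a2 * b1))"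

definition torsion :: "complex \<times> complex \<times> complex \<Rightarrow> complex \<times> complex \<times> complex" where
  "torsion = (\<lambda>(n1, n2, n3). (- \<i> * cnj n1 / 2, - \<i> * cnj n2 / 2, - \<i> * cnj n3))"

text \<open>A skew \<open>X\<close> splits into a part in the stabiliser u(2) of the model point,
  seen by \<open>isot\<close>, and a complement, seen by \<open>tancoord\<close>. Modulo u(2), a
  stabiliser part bracketed with a complement part gives the complex linear isotropy action, two
  stabiliser parts give nothing, and two complement parts give the \<open>torsion\<close>
  term.\<close>

lemma tancoord_bracket:
  assumes "transpose X = - X" "transpose Y = - Y"
  shows "tancoord (lie_bracket X Y)
    = isot X (tancoord Y) - isot Y (tancoord X) + torsion (ccross3 (tancoord X) (tancoord Y))"
  unfolding lie_bracket_def tancoord_def isot_def Let_def torsion_def ccross3_def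
  by (simp add: matrix_matrix_mult_def sum_5 skew_entries[OF assms(1)] skew_entries[OF assms(2)] complex_eq_iff)
     (simp add: field_simps)

text \<open>This combination kills the terms that are complex linear in one tangent vector and quadruples
  the conjugate-bilinear one.\<close>

lemma bracket_identity:
  assumes sk: "transpose X1 = - X1" "transpose X2 = - X2" "transpose X3 = - X3" "transpose X4 = - X4"
    and u: "tancoord X2 = iscale (tancoord X1)" and w: "tancoord X4 = iscale (tancoord X3)"
  shows "tancoord (lie_bracket X1 X3) - tancoord (lie_bracket X2 X4)
      + iscale (tancoord (lie_bracket X1 X4) + tancoord (lie_bracket X2 X3))
    = 4 *\<^sub>R torsion (ccross3 (tancoord X1) (tancoord X3))"
proof -
  obtain u1 u2 u3 w1 w2 w3 where
    uw: "tancoord X1 = (u1, u2, u3)" "tancoord X3 = (w1, w2, w3)"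
    by (metis prod_cases3)
  show ?thesis
    unfolding tancoord_bracket[OF sk(1,3)] tancoord_bracket[OF sk(2,4)]
      tancoord_bracket[OF sk(1,4)] tancoord_bracket[OF sk(2,3)] u w uw
    by (simp add: isot_def torsion_def ccross3_def iscale_def Let_def field_simps scaleR_conv_of_real)
qed

section \<open>Complex linear algebra of real subspaces of C^3\<close>

lemma iscale_iscale [simp]: "iscale (iscale z) = - z"
  by (cases z) (simp add: iscale_def flip: mult.assoc)

lemma linear_iscale: "linear iscale"
  by (rule linearI) (auto simp: iscale_def algebra_simps)

lemma det3_iscale: "det3 (iscale a) b c = \<i> * det3 a b c" "det3 a b (iscale c) = \<i> * det3 a b c"
  by (cases a; cases b; cases c; simp add: det3_def iscale_def algebra_simps)+

lemma det3_add: "det3 a b (c + d) = det3 a b c + det3 a b d"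
  and det3_diff: "det3 a b (c - d) = det3 a b c - det3 a b d"
  by (cases a; cases b; cases c; cases d; simp add: det3_def algebra_simps)+

lemma det3_conv_ccross3:
  "det3 a b c = fst (ccross3 a b) * fst c + fst (snd (ccross3 a b)) * fst (snd c)
     + snd (snd (ccross3 a b)) * snd (snd c)"
  by (cases a; cases b; cases c; simp add: det3_def ccross3_def algebra_simps)

text \<open>The minors are paired with their own conjugates, so the value vanishes only if all
  minors do. The factors 2, 2, 4 are four times the coefficients 1/2, 1/2, 1 in
  \<open>torsion\<close>.\<close>

lemma det3_torsion_ccross3:
  assumes "ccross3 a b = (n1, n2, n3)"
  shows "det3 a b (4 *\<^sub>R torsion (ccross3 a b))
    = - \<i> * of_real (2 * (cmod n1)\<^sup>2 + 2 * (cmod n2)\<^sup>2 + 4 * (cmod n3)\<^sup>2)"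
  unfolding det3_conv_ccross3
  by (simp add: assms torsion_def scaleR_conv_of_real complex_norm_square[unfolded of_real_power] algebra_simps)

lemma cmult_in_span_iscale: "(c * a1, c * a2, c * a3) \<in> span {(a1, a2, a3), iscale (a1, a2, a3)}"
proof -
  have "(c * a1, c * a2, c * a3) = Re c *\<^sub>R (a1, a2, a3) + Im c *\<^sub>R iscale (a1, a2, a3)"
    by (simp add: iscale_def complex_eq_iff algebra_simps)
  also have "\<dots> \<in> span {(a1, a2, a3), iscale (a1, a2, a3)}"
    by (intro span_add span_scale span_base) auto
  finally show ?thesis .
qed

lemma ccross3_eq_0_imp_in_span:
  assumes "ccross3 u w = 0" "u \<noteq> 0"
  shows "w \<in> span {u, iscale u}"
proof -
  obtain u1 u2 u3 w1 w2 w3 where uw: "u = (u1, u2, u3)" "w = (w1, w2, w3)"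
    by (metis prod_cases3)
  have n: "u2 * w3 = u3 * w2" "u3 * w1 = u1 * w3" "u1 * w2 = u2 * w1"
    using assms(1) by (simp_all add: uw ccross3_def zero_prod_def)
  consider "u1 \<noteq> 0" | "u2 \<noteq> 0" | "u3 \<noteq> 0"
    using assms(2) by (auto simp: uw zero_prod_def)
  then have "\<exists>c. w1 = c * u1 \<and> w2 = c * u2 \<and> w3 = c * u3"
  proof cases
    case 1 then show ?thesis using n by (intro exI[of _ "w1 / u1"]) (simp add: field_simps)
  next
    case 2 then show ?thesis using n by (intro exI[of _ "w2 / u2"]) (simp add: field_simps)
  next
    case 3 then show ?thesis using n by (intro exI[of _ "w3 / u3"]) (simp add: field_simps)
  qed
  then show ?thesis
    using cmult_in_span_iscale[of _ u1 u2 u3] uw by metis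
qed

text \<open>Cramer's rule, with a non-zero minor of \<open>u\<close>, \<open>w\<close> as the
  denominator.\<close>

lemma det3_eq_0_imp_in_span:
  assumes "det3 u w z = 0" "ccross3 u w \<noteq> 0"
  shows "z \<in> span {u, iscale u, w, iscale w}"
proof -
  obtain u1 u2 u3 w1 w2 w3 z1 z2 z3 where
    uw: "u = (u1, u2, u3)" "w = (w1, w2, w3)" "z = (z1, z2, z3)"
    by (metis prod_cases3)
  define n1 n2 n3 where n: "n1 = u2 * w3 - u3 * w2" "n2 = u3 * w1 - u1 * w3" "n3 = u1 * w2 - u2 * w1"
  have d: "n1 * z1 + n2 * z2 + n3 * z3 = 0"
    using assms(1) by (simp add: uw det3_def n algebra_simps)
  consider "n1 \<noteq> 0" | "n2 \<noteq> 0" | "n3 \<noteq> 0"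
    using assms(2) by (auto simp: uw zero_prod_def ccross3_def n)
  then have "\<exists>a b. z1 = a * u1 + b * w1 \<and> z2 = a * u2 + b * w2 \<and> z3 = a * u3 + b * w3"
  proof cases
    case 1
    \<comment> \<open>The minor \<open>n1\<close> belongs to coordinates 2 and 3, where Cramer's
      rule is an identity; only the remaining coordinate needs \<open>d\<close>.\<close>
    have "n1 * z1 = (z2 * w3 - z3 * w2) * u1 + (u2 * z3 - u3 * z2) * w1"
      using d unfolding n by algebra
    moreover have "n1 * z2 = (z2 * w3 - z3 * w2) * u2 + (u2 * z3 - u3 * z2) * w2" "n1 * z3 = (z2 * w3 - z3 * w2) * u3 + (u2 * z3 - u3 * z2) * w3"
      by (simp_all add: n algebra_simps)
    ultimately show ?thesis using 1
      by (intro exI[of _ "(z2 * w3 - z3 * w2) / n1"] exI[of _ "(u2 * z3 - u3 * z2) / n1"])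
        (simp add: eq_divide_eq mult.commute flip: add_divide_distrib)
  next
    case 2
    have "n2 * z2 = (z3 * w1 - z1 * w3) * u2 + (u3 * z1 - u1 * z3) * w2"
      using d unfolding n by algebra
    moreover have "n2 * z1 = (z3 * w1 - z1 * w3) * u1 + (u3 * z1 - u1 * z3) * w1" "n2 * z3 = (z3 * w1 - z1 * w3) * u3 + (u3 * z1 - u1 * z3) * w3"
      by (simp_all add: n algebra_simps)
    ultimately show ?thesis using 2
      by (intro exI[of _ "(z3 * w1 - z1 * w3) / n2"] exI[of _ "(u3 * z1 - u1 * z3) / n2"])
        (simp add: eq_divide_eq mult.commute flip: add_divide_distrib)
  next
    case 3
    have "n3 * z3 = (z1 * w2 - z2 * w1) * u3 + (u1 * z2 - u2 * z1) * w3"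
      using d unfolding n by algebra
    moreover have "n3 * z1 = (z1 * w2 - z2 * w1) * u1 + (u1 * z2 - u2 * z1) * w1" "n3 * z2 = (z1 * w2 - z2 * w1) * u2 + (u1 * z2 - u2 * z1) * w2"
      by (simp_all add: n algebra_simps)
    ultimately show ?thesis using 3
      by (intro exI[of _ "(z1 * w2 - z2 * w1) / n3"] exI[of _ "(u1 * z2 - u2 * z1) / n3"])
        (simp add: eq_divide_eq mult.commute flip: add_divide_distrib)
  qed
  then obtain a b where "z = (a * u1, a * u2, a * u3) + (b * w1, b * w2, b * w3)"
    using uw by auto
  moreover have "(a * u1, a * u2, a * u3) \<in> span {u, iscale u, w, iscale w}"
    using cmult_in_span_iscale[of a u1 u2 u3] span_mono[of "{u, iscale u}" "{u, iscale u, w, iscale w}"] uw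
    by auto
  moreover have "(b * w1, b * w2, b * w3) \<in> span {u, iscale u, w, iscale w}"
    using cmult_in_span_iscale[of b w1 w2 w3] span_mono[of "{w, iscale w}" "{u, iscale u, w, iscale w}"] uw
    by auto
  ultimately show ?thesis
    by (simp only: span_add)
qed

lemma Re_det3_zero_imp_complex_plane:
  assumes T: "subspace T" and dimT: "4 \<le> dim T"
    and re: "\<And>a b c. a \<in> T \<Longrightarrow> b \<in> T \<Longrightarrow> c \<in> T \<Longrightarrow> Re (det3 a b c) = 0"
  obtains u w where "u \<in> T" "iscale u \<in> T" "w \<in> T" "iscale w \<in> T" "ccross3 u w \<noteq> 0"
    "\<And>z. z \<in> T \<Longrightarrow> det3 u w z = 0"
proof -
  have inj: "inj iscale"
    by (metis injI iscale_iscale neg_equal_iff_equal)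
  have T': "subspace (iscale ` T)"
    by (rule linear_subspace_image[OF linear_iscale T])
  have "dim (iscale ` T) = dim T"
    using inj by (intro dim_image_eq linear_iscale) (auto simp: inj_on_def)
  moreover have "dim {x + y |x y. x \<in> T \<and> y \<in> iscale ` T} \<le> 6"
    using dim_subset_UNIV[of "{x + y |x y. x \<in> T \<and> y \<in> iscale ` T}"] by simp
  \<comment> \<open>The dimension is at least 4 + 4 - 6 = 2.\<close>
  ultimately have "dim (T \<inter> iscale ` T) \<noteq> 0"
    using dim_sums_Int[OF T T'] dimT by linarith
  then obtain u where u: "u \<in> T" "u \<in> iscale ` T" "u \<noteq> 0"
    by (metis IntE dim_eq_0 singleton_iff subsetI)
  then obtain u' where "u = iscale u'" "u' \<in> T"
    by blast
  then have iu: "iscale u \<in> T"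
    using subspace_neg[OF T] by simp
  \<comment> \<open>\<open>re\<close> controls only real parts; inserting \<open>iscale u\<close> in
    place of \<open>u\<close> controls the imaginary part as well.\<close>
  have det0: "det3 u a b = 0" if "a \<in> T" "b \<in> T" for a b
    using re[OF u(1) that] re[OF iu that] by (simp add: det3_iscale complex_eq_iff)
  have "dim (span {u, iscale u}) \<le> 2"
    by (simp, rule order_trans[OF dim_le_card']) (auto simp: card_insert_if)
  then have "\<not> T \<subseteq> span {u, iscale u}"
    using dim_subset[of T "span {u, iscale u}"] dimT by linarith
  then obtain w where w: "w \<in> T" "w \<notin> span {u, iscale u}"
    by blast
  then have n: "ccross3 u w \<noteq> 0"
    using ccross3_eq_0_imp_in_span u(3) by blast
  \<comment> \<open>\<open>T\<close> lies in the complex plane through \<open>u\<close> and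
    \<open>w\<close>, whose real dimension is at most 4, and therefore fills it.\<close>
  have "T \<subseteq> span {u, iscale u, w, iscale w}"
    using det3_eq_0_imp_in_span n det0 w(1) by blast
  moreover have "dim (span {u, iscale u, w, iscale w}) \<le> 4"
    by (simp, rule order_trans[OF dim_le_card']) (auto simp: card_insert_if)
  ultimately have "T = span {u, iscale u, w, iscale w}"
    using T dimT by (intro subspace_dim_equal) auto
  then have "iscale w \<in> T"
    by (simp add: span_base)
  then show thesis
    using that u iu w(1) n det0 by blast
qed

lemma linear_tancoord: "linear tancoord"
  by (rule linearI) (auto simp: tancoord_def complex_eq_iff algebra_simps)

text \<open>Since brackets stay in \<open>k\<close>, \<open>det3 u w\<close> annihilates the
  combination in \<open>bracket_identity\<close>, whereas \<open>det3_torsion_ccross3\<close>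
  evaluates it to something non-zero. The lifts \<open>X1\<close> to \<open>X4\<close> are
  determined only modulo the kernel of \<open>tancoord\<close>; the identity holds for every
  choice.\<close>

lemma no_complex_subalgebra:
  assumes k: "subspace k" and skew: "\<And>X. X \<in> k \<Longrightarrow> transpose X = - X"
    and br: "\<And>X Y. X \<in> k \<Longrightarrow> Y \<in> k \<Longrightarrow> lie_bracket X Y \<in> k"
    and dimk: "4 \<le> dim (tancoord ` k)"
    and re: "\<And>X Y Z. X \<in> k \<Longrightarrow> Y \<in> k \<Longrightarrow> Z \<in> k \<Longrightarrow>
      Re (det3 (tancoord X) (tancoord Y) (tancoord Z)) = 0"
  shows False
proof -
  have "subspace (tancoord ` k)"
    by (rule linear_subspace_image[OF linear_tancoord k])
  then obtain u w where uw: "u \<in> tancoord ` k" "iscale u \<in> tancoord ` k" "w \<in> tancoord ` k"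
      "iscale w \<in> tancoord ` k" "ccross3 u w \<noteq> 0" "\<And>z. z \<in> tancoord ` k \<Longrightarrow> det3 u w z = 0"
    by (rule Re_det3_zero_imp_complex_plane[OF _ dimk]) (use re in auto)
  have lift: "\<exists>X. X \<in> k \<and> tancoord X = z" if "z \<in> tancoord ` k" for z
    using that by auto
  obtain X1 X2 X3 X4 where X: "X1 \<in> k" "X2 \<in> k" "X3 \<in> k" "X4 \<in> k"
    "tancoord X1 = u" "tancoord X2 = iscale u" "tancoord X3 = w" "tancoord X4 = iscale w"
    using lift[OF uw(1)] lift[OF uw(2)] lift[OF uw(3)] lift[OF uw(4)] by (elim exE conjE) (rule that)
  have d0: "det3 u w (tancoord (lie_bracket X Y)) = 0" if "X \<in> k" "Y \<in> k" for X Y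
    using uw(6) br that by blast
  obtain n1 n2 n3 where n: "ccross3 u w = (n1, n2, n3)"
    by (metis prod_cases3)
  have "det3 u w (4 *\<^sub>R torsion (ccross3 u w)) = 0"
    unfolding X(5,7)[symmetric]
    by (subst bracket_identity[symmetric, of X1 X2 X3 X4])
      (simp_all add: skew X det3_add det3_diff det3_iscale d0)
  then have "2 * (cmod n1)\<^sup>2 + 2 * (cmod n2)\<^sup>2 + 4 * (cmod n3)\<^sup>2 = 0"
    by (simp only: det3_torsion_ccross3[OF n]) (metis complex_i_not_zero mult_eq_0_iff neg_equal_0_iff_equal of_real_eq_0_iff)
  then have "n1 = 0 \<and> n2 = 0 \<and> n3 = 0"
    by (smt (verit) zero_le_power2 power_eq_0_iff norm_eq_zero)
  then show False
    using uw(5) n by (simp add: zero_prod_def)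
qed

section \<open>The Lie algebra of a compact matrix group\<close>

lemma bounded_bilinear_matrix_mult:
  "bounded_bilinear ((**) :: real^'n^'m \<Rightarrow> real^'k^'n \<Rightarrow> real^'k^'m)"
  unfolding bilinear_conv_bounded_bilinear[symmetric] bilinear_def
  by (auto intro!: linearI simp: matrix_matrix_mult_def vec_eq_iff sum.distrib algebra_simps sum_distrib_left)

lemma bounded_bilinear_matrix_vector_mult:
  "bounded_bilinear ((*v) :: real^'n^'m \<Rightarrow> real^'n \<Rightarrow> real^'m)"
  unfolding bilinear_conv_bounded_bilinear[symmetric] bilinear_def
  by (auto intro!: linearI simp: matrix_vector_mult_def vec_eq_iff sum.distrib algebra_simps sum_distrib_left)

lemma bounded_linear_transpose: "bounded_linear (transpose :: real^'n^'m \<Rightarrow> real^'m^'n)"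
  unfolding linear_conv_bounded_linear[symmetric]
  by (auto intro!: linearI simp: transpose_def vec_eq_iff)

interpretation matmul: bounded_bilinear "(**) :: real^'n^'m \<Rightarrow> real^'k^'n \<Rightarrow> real^'k^'m"
  by (rule bounded_bilinear_matrix_mult)

interpretation matvec: bounded_bilinear "(*v) :: real^'n^'m \<Rightarrow> real^'n \<Rightarrow> real^'m"
  by (rule bounded_bilinear_matrix_vector_mult)

lemmas has_vector_derivative_transpose = bounded_linear.has_vector_derivative[OF bounded_linear_transpose]
  and tendsto_transpose = bounded_linear.tendsto[OF bounded_linear_transpose]
  and transpose_diff = linear_diff[OF bounded_linear.linear[OF bounded_linear_transpose]]
  and transpose_scaleR = linear_scale[OF bounded_linear.linear[OF bounded_linear_transpose]]

lemma has_vector_derivative_at_0_iff: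
  "(f has_vector_derivative D) (at (0::real)) \<longleftrightarrow> ((\<lambda>t. (f t - f 0) /\<^sub>R t) \<longlongrightarrow> D) (at 0)"
proof -
  have "(f has_vector_derivative D) (at 0) \<longleftrightarrow> ((\<lambda>h. norm (f h - f 0 - h *\<^sub>R D) / norm h) \<longlongrightarrow> 0) (at 0)"
    by (simp add: has_vector_derivative_def has_derivative_at bounded_linear_scaleR_left)
  also have "\<dots> \<longleftrightarrow> ((\<lambda>t. norm ((f t - f 0) /\<^sub>R t - D)) \<longlongrightarrow> 0) (at 0)"
  proof (intro filterlim_cong refl eventually_at_filter[THEN iffD2] always_eventually allI impI)
    fix h :: real assume "h \<noteq> 0"
    then have "(f h - f 0) /\<^sub>R h - D = (f h - f 0 - h *\<^sub>R D) /\<^sub>R h"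
      by (simp add: scaleR_diff_right)
    then show "norm (f h - f 0 - h *\<^sub>R D) / norm h = norm ((f h - f 0) /\<^sub>R h - D)"
      by (simp add: divide_inverse mult.commute)
  qed
  also have "\<dots> \<longleftrightarrow> ((\<lambda>t. (f t - f 0) /\<^sub>R t) \<longlongrightarrow> D) (at 0)"
    by (simp add: tendsto_norm_zero_iff LIM_zero_iff)
  finally show ?thesis .
qed

lemma norm_transpose: "norm (transpose M) = norm (M :: real^'n^'m)"
proof -
  have "transpose M \<bullet> transpose M = M \<bullet> M"
    unfolding inner_vec_def transpose_def by simp (rule sum.swap)
  then show ?thesis
    by (simp add: norm_eq_sqrt_inner)
qed

lemma norm_orthogonal_matrix_vector:
  assumes "orthogonal_matrix g"
  shows "norm (g *v x) = norm (x :: real^'n)"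
proof -
  have "(g *v x) \<bullet> (g *v x) = (transpose g *v (g *v x)) \<bullet> x"
    by (simp add: dot_lmul_matrix)
  also have "\<dots> = x \<bullet> x"
    using assms by (simp only: matrix_vector_mul_assoc orthogonal_matrix_def matrix_vector_mul_lid)
  finally show ?thesis
    by (simp add: norm_eq_sqrt_inner)
qed

lemma norm_mult_orthogonal_matrix:
  assumes "orthogonal_matrix g"
  shows "norm (M ** g) = norm (M :: real^'n^'m)"
proof -
  have "(M ** g) $ i = transpose g *v (M $ i)" for i
    by (simp add: vec_eq_iff matrix_matrix_mult_def vector_matrix_mult_def mult.commute)
  moreover have "norm (transpose g *v x) = norm x" for x
    using assms norm_orthogonal_matrix_vector orthogonal_matrix_transpose by blast
  ultimately show ?thesis
    by (simp add: norm_vec_def)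
qed

lemma norm_orthogonal_matrix_mult:
  assumes "orthogonal_matrix g"
  shows "norm (g ** M) = norm (M :: real^'n^'m)"
  by (metis assms matrix_transpose_mul norm_mult_orthogonal_matrix norm_transpose
      orthogonal_matrix_transpose)

section \<open>Powers of an orthogonal matrix close to the identity\<close>

definition matpow :: "real^'n^'n \<Rightarrow> nat \<Rightarrow> real^'n^'n" where
  "matpow g m = (((**) g) ^^ m) (mat 1)"

lemma matpow_0 [simp]: "matpow g 0 = mat 1"
  and matpow_Suc [simp]: "matpow g (Suc m) = g ** matpow g m"
  by (simp_all add: matpow_def)

text \<open>Multiplication by an orthogonal matrix preserves the norm, so errors add up instead of
  growing exponentially.\<close>

lemma norm_matpow_minus_one:
  assumes "orthogonal_matrix g"
  shows "norm (matpow g m - mat 1) \<le> real m * norm (g - mat 1)"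
proof (induction m)
  case (Suc m)
  have "matpow g (Suc m) - mat 1 = g ** (matpow g m - mat 1) + (g - mat 1)"
    by (simp add: matmul.diff_right)
  then have "norm (matpow g (Suc m) - mat 1) \<le> norm (matpow g m - mat 1) + norm (g - mat 1)"
    by (metis assms norm_orthogonal_matrix_mult norm_triangle_ineq)
  then show ?case
    using Suc by (simp add: algebra_simps)
qed simp

text \<open>Passing from \<open>m\<close> to \<open>Suc m\<close> adds
  \<open>(g - mat 1) ** (matpow g m - mat 1)\<close> to the remainder, and m^2 + m <= (m+1)^2 closes
  the induction. The bound involves only the product of \<open>m\<close> and
  \<open>norm (g - mat 1)\<close>, so it survives a limit in which \<open>m\<close> tends to
  infinity and this product converges.\<close>

lemma norm_matpow_linear_approx:
  fixes g :: "real^'n^'n"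
  assumes g: "orthogonal_matrix g"
    and C: "0 \<le> C" "\<And>(A :: real^'n^'n) (B :: real^'n^'n). norm (A ** B) \<le> norm A * norm B * C"
  shows "norm (matpow g m - mat 1 - real m *\<^sub>R (g - mat 1)) \<le> C * (real m * norm (g - mat 1))\<^sup>2"
proof (induction m)
  case (Suc m)
  define d where "d = norm (g - mat 1)"
  have d: "d \<ge> 0" by (simp add: d_def)
  have "matpow g (Suc m) - mat 1 - real (Suc m) *\<^sub>R (g - mat 1)
      = (matpow g m - mat 1 - real m *\<^sub>R (g - mat 1)) + (g - mat 1) ** (matpow g m - mat 1)"
    by (simp add: matmul.diff_right matmul.diff_left algebra_simps)
  then have "norm (matpow g (Suc m) - mat 1 - real (Suc m) *\<^sub>R (g - mat 1))
      \<le> C * (real m * d)\<^sup>2 + norm ((g - mat 1) ** (matpow g m - mat 1))"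
    using Suc norm_triangle_ineq unfolding d_def by (smt (verit, best))
  also have "norm ((g - mat 1) ** (matpow g m - mat 1)) \<le> d * norm (matpow g m - mat 1) * C"
    unfolding d_def by (rule C(2))
  also have "d * norm (matpow g m - mat 1) * C \<le> d * (real m * d) * C"
    using norm_matpow_minus_one[OF g, of m] d C(1) unfolding d_def[symmetric]
    by (intro mult_right_mono mult_left_mono) auto
  also have "C * (real m * d)\<^sup>2 + d * (real m * d) * C \<le> C * (real (Suc m) * d)\<^sup>2"
  proof -
    have "(real m * d)\<^sup>2 + d * (real m * d) \<le> (real (Suc m) * d)\<^sup>2"
      using d by (simp add: power2_eq_square algebra_simps)
    from mult_left_mono[OF this C(1)] show ?thesis
      by (simp add: algebra_simps)
  qed
  finally show ?case
    by (simp add: d_def)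
qed simp

locale compact_matrix_group =
  fixes K :: "(real^'n^'n) set"
  assumes orth: "g \<in> K \<Longrightarrow> orthogonal_matrix g"
    and one_mem: "mat 1 \<in> K"
    and mult_mem: "g \<in> K \<Longrightarrow> h \<in> K \<Longrightarrow> g ** h \<in> K"
    and transpose_mem: "g \<in> K \<Longrightarrow> transpose g \<in> K"
    and closed: "closed K"
begin

lemma transpose_mult: "g \<in> K \<Longrightarrow> transpose g ** g = mat 1"
  and mult_transpose: "g \<in> K \<Longrightarrow> g ** transpose g = mat 1"
  using orth by (auto simp: orthogonal_matrix_def)

lemma compact: "compact K"
proof -
  have "norm g = norm (mat 1 :: real^'n^'n)" if "g \<in> K" for g
    using norm_orthogonal_matrix_mult[OF orth[OF that], of "mat 1"] by simp
  then have "bounded K"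
    unfolding bounded_iff by (metis order_refl)
  then show ?thesis
    using closed compact_eq_bounded_closed by blast
qed

lemma matpow_mem: "g \<in> K \<Longrightarrow> matpow g m \<in> K"
  by (induction m) (auto simp: one_mem mult_mem)

text \<open>The curves have the same regularity as in \<open>tangent_vecs\<close>, so acting on a
  point turns them directly into admissible curves of the orbit. A family in \<open>K\<close> with a
  quadratic error bound already yields a member.\<close>

definition lie_algebra :: "(real^'n^'n) set" where
  "lie_algebra = {X. \<exists>h. (\<forall>t::real. h t \<in> K) \<and> h 0 = mat 1 \<and> (h has_vector_derivative X) (at 0)}"

lemma lie_algebraE:
  assumes "X \<in> lie_algebra"
  obtains h :: "real \<Rightarrow> real^'n^'n" where "\<And>t. h t \<in> K" "h 0 = mat 1" "(h has_vector_derivative X) (at 0)"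
  using assms unfolding lie_algebra_def by blast

lemma lie_algebraI:
  "(\<And>t::real. h t \<in> K) \<Longrightarrow> h 0 = mat 1 \<Longrightarrow> (h has_vector_derivative X) (at 0) \<Longrightarrow> X \<in> lie_algebra"
  unfolding lie_algebra_def by blast

lemma subspace_lie_algebra: "subspace lie_algebra"
proof (rule subspaceI)
  show "0 \<in> lie_algebra"
    by (rule lie_algebraI[of "\<lambda>_. mat 1"]) (auto simp: one_mem)
next
  fix X Y assume "X \<in> lie_algebra" "Y \<in> lie_algebra"
  then obtain h h' where h: "\<And>t::real. h t \<in> K" "h 0 = mat 1" "(h has_vector_derivative X) (at 0)"
    and h': "\<And>t::real. h' t \<in> K" "h' 0 = mat 1" "(h' has_vector_derivative Y) (at 0)"
    by (metis lie_algebraE)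
  have "((\<lambda>t. h t ** h' t) has_vector_derivative X + Y) (at 0)"
    using matmul.has_vector_derivative[OF h(3) h'(3)] h(2) h'(2) by (simp add: add.commute)
  then show "X + Y \<in> lie_algebra"
    by (rule lie_algebraI[rotated 2]) (auto simp: h h' mult_mem)
next
  fix c :: real and X assume "X \<in> lie_algebra"
  then obtain h where h: "\<And>t::real. h t \<in> K" "h 0 = mat 1" "(h has_vector_derivative X) (at 0)"
    by (metis lie_algebraE)
  have "((\<lambda>t. c * t) has_vector_derivative c) (at 0)"
    by (auto intro!: derivative_eq_intros)
  from vector_diff_chain_at[OF this, of h X]
  have "((\<lambda>t. h (c * t)) has_vector_derivative c *\<^sub>R X) (at 0)"
    using h(3) by (simp add: o_def)
  then show "c *\<^sub>R X \<in> lie_algebra"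
    by (rule lie_algebraI[rotated 2]) (auto simp: h)
qed

lemma lie_algebra_skew:
  assumes "X \<in> lie_algebra"
  shows "transpose X = - X"
proof -
  obtain h where h: "\<And>t::real. h t \<in> K" "h 0 = mat 1" "(h has_vector_derivative X) (at 0)"
    using assms by (metis lie_algebraE)
  have "((\<lambda>t. h t ** transpose (h t)) has_vector_derivative transpose X + X) (at 0)"
    using matmul.has_vector_derivative[OF h(3) has_vector_derivative_transpose[OF h(3)]] h(2) by simp
  moreover have "(\<lambda>t. h t ** transpose (h t)) = (\<lambda>t. mat 1)"
    using h(1) mult_transpose by auto
  ultimately have "((\<lambda>t::real. mat 1 :: real^'n^'n) has_vector_derivative transpose X + X) (at 0)"
    by simp
  then have "transpose X + X = 0"
    by (rule vector_derivative_unique_at) simp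
  then show ?thesis
    by (simp add: eq_neg_iff_add_eq_0)
qed

lemma lie_algebra_Ad:
  assumes "g \<in> K" "X \<in> lie_algebra"
  shows "g ** X ** transpose g \<in> lie_algebra"
proof -
  obtain h where h: "\<And>t::real. h t \<in> K" "h 0 = mat 1" "(h has_vector_derivative X) (at 0)"
    using assms by (metis lie_algebraE)
  have "((\<lambda>t. g ** h t ** transpose g) has_vector_derivative g ** X ** transpose g) (at 0)"
    by (rule bounded_linear.has_vector_derivative[OF matmul.bounded_linear_left
          bounded_linear.has_vector_derivative[OF matmul.bounded_linear_right h(3)]])
  then show ?thesis
    by (rule lie_algebraI[rotated 2]) (auto simp: h assms mult_mem transpose_mem mult_transpose)
qed

text \<open>The bracket is the derivative at the identity of the adjoint action, which stays in the
  (closed) subspace \<^term>\<open>lie_algebra\<close>.\<close>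

lemma lie_algebra_bracket:
  assumes "X \<in> lie_algebra" "Y \<in> lie_algebra"
  shows "lie_bracket X Y \<in> lie_algebra"
proof -
  obtain h where h: "\<And>t::real. h t \<in> K" "h 0 = mat 1" "(h has_vector_derivative X) (at 0)"
    using assms by (metis lie_algebraE)
  have "((\<lambda>t. h t ** Y) has_vector_derivative X ** Y) (at 0)"
    by (rule bounded_linear.has_vector_derivative[OF matmul.bounded_linear_left h(3)])
  from matmul.has_vector_derivative[OF this has_vector_derivative_transpose[OF h(3)]]
  have "((\<lambda>t. h t ** Y ** transpose (h t)) has_vector_derivative lie_bracket X Y) (at 0)"
    using h(2) by (simp add: lie_bracket_def lie_algebra_skew[OF assms(1)] matmul.minus_right)
  then have lim: "((\<lambda>t. (h t ** Y ** transpose (h t) - Y) /\<^sub>R t) \<longlongrightarrow> lie_bracket X Y) (at 0)"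
    using h(2) by (simp add: has_vector_derivative_at_0_iff)
  have "closed lie_algebra"
    by (simp add: closed_subspace subspace_lie_algebra)
  moreover have "(h t ** Y ** transpose (h t) - Y) /\<^sub>R t \<in> lie_algebra" for t
    by (intro subspace_scale subspace_diff subspace_lie_algebra lie_algebra_Ad h assms)
  ultimately show ?thesis
    using Lim_in_closed_set[OF _ _ _ lim] by simp
qed

end

section \<open>Tangent vectors of orbits\<close>

lemma compact_convergent_subseqE:
  assumes "compact (S :: 'a::metric_space set)" "\<And>n. f n \<in> S"
  obtains l r where "l \<in> S" "strict_mono (r :: nat \<Rightarrow> nat)" "(\<lambda>n. f (r n)) \<longlonglongrightarrow> l"
proof -
  have "\<exists>l\<in>S. \<exists>r. strict_mono (r :: nat \<Rightarrow> nat) \<and> (f \<circ> r) \<longlonglongrightarrow> l"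
    using assms(1) unfolding compact_def by (rule allE[of _ f]) (simp add: assms(2))
  then show thesis
    using that by (auto simp: o_def)
qed

definition inf_act :: "mat5 \<Rightarrow> pt5 \<times> mat5 \<Rightarrow> pt5 \<times> mat5" where
  "inf_act X p = (X *v fst p, X ** snd p + snd p ** transpose X)"

lemma act_one [simp]: "act (mat 1) p = p"
  by (simp add: act_def transpose_mat)

lemma act_mult: "act (g ** h) p = act g (act h p)"
  by (simp add: act_def matrix_transpose_mul matrix_mul_assoc matrix_vector_mul_assoc)

lemma act_diff: "act g p - act g q = act g (p - q)"
  by (simp add: act_def matvec.diff_right matmul.diff_right matmul.diff_left)

lemma norm_act: "orthogonal_matrix g \<Longrightarrow> norm (act g p) = norm p"
  by (simp add: act_def norm_prod_def norm_orthogonal_matrix_vector norm_mult_orthogonal_matrix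
      norm_orthogonal_matrix_mult)

lemma linear_inf_act: "linear (\<lambda>X. inf_act X p)"
  by (rule linearI)
    (simp_all add: inf_act_def matvec.add_left matmul.add_left matvec.scaleR_left matmul.scaleR_left
      linear_add[OF bounded_linear.linear[OF bounded_linear_transpose]] transpose_scaleR
      matmul.add_right matmul.scaleR_right scaleR_add_right)

lemma tendsto_act: "(f \<longlongrightarrow> g) F \<Longrightarrow> ((\<lambda>x. act (f x) p) \<longlongrightarrow> act g p) F"
  unfolding act_def by (intro tendsto_Pair matvec.tendsto matmul.tendsto tendsto_transpose tendsto_const)

text \<open>The product rule as an exact identity: g A g^T - A = (g - 1) A g^T + A (g - 1)^T. The
  filter and the scale \<open>c\<close> are arbitrary because both curves at 0 and sequences with
  their own scale occur.\<close>

lemma tendsto_act_quotient: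
  assumes g: "(g \<longlongrightarrow> mat 1) F" and X: "((\<lambda>x. c x *\<^sub>R (g x - mat 1)) \<longlongrightarrow> X) F"
  shows "((\<lambda>x. c x *\<^sub>R (act (g x) p - p)) \<longlongrightarrow> inf_act X p) F"
proof -
  have eq: "c x *\<^sub>R (act (g x) p - p) = ((c x *\<^sub>R (g x - mat 1)) *v fst p,
      (c x *\<^sub>R (g x - mat 1)) ** (snd p ** transpose (g x))
        + snd p ** transpose (c x *\<^sub>R (g x - mat 1)))" for x
    by (cases p) (simp add: act_def matvec.diff_left matvec.scaleR_left matmul.diff_left matmul.diff_right
        matmul.scaleR_left matmul.scaleR_right transpose_diff transpose_scaleR transpose_mat
        matrix_mul_assoc scaleR_diff_right)
  have "((\<lambda>x. ((c x *\<^sub>R (g x - mat 1)) *v fst p,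
      (c x *\<^sub>R (g x - mat 1)) ** (snd p ** transpose (g x))
        + snd p ** transpose (c x *\<^sub>R (g x - mat 1)))) \<longlongrightarrow>
     (X *v fst p, X ** (snd p ** transpose (mat 1)) + snd p ** transpose X)) F"
    by (intro tendsto_Pair tendsto_add matvec.tendsto matmul.tendsto tendsto_transpose tendsto_const g X)
  then show ?thesis
    by (simp add: eq inf_act_def transpose_mat)
qed

lemma norm_act_matpow:
  assumes "orthogonal_matrix g"
  shows "norm (act (matpow g m) p - p) \<le> real m * norm (act g p - p)"
proof (induction m)
  case (Suc m)
  have "act (matpow g (Suc m)) p - p = act g (act (matpow g m) p - p) + (act g p - p)"
    by (simp add: act_mult flip: act_diff)
  then have "norm (act (matpow g (Suc m)) p - p) \<le> norm (act (matpow g m) p - p) + norm (act g p - p)"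
    by (metis assms norm_act norm_triangle_ineq)
  then show ?case
    using Suc by (simp add: algebra_simps)
qed simp

context
  fixes K :: "mat5 set"
  assumes K: "compact_matrix_group K"
begin

interpretation compact_matrix_group K by (rule K)

text \<open>Powers \<open>g\<^sub>n ^ m\<^sub>n\<close> with \<open>m\<^sub>n \<epsilon>\<^sub>n \<rightarrow> t\<close> accumulate at an element of the
  group which plays the role of \<open>exp (t X)\<close>, and which fixes \<open>p\<close> if the \<open>g\<^sub>n\<close> do so to
  first order.\<close>

lemma limit_direction_nonneg:
  assumes g: "\<And>n. g n \<in> K" and e: "\<And>n. 0 < e n" "e \<longlonglongrightarrow> 0"
    and X: "(\<lambda>n. (g n - mat 1) /\<^sub>R e n) \<longlonglongrightarrow> X"
    and p: "(\<lambda>n. (act (g n) p - p) /\<^sub>R e n) \<longlonglongrightarrow> 0"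
    and C: "0 \<le> C" "\<And>(A :: mat5) (B :: mat5). norm (A ** B) \<le> norm A * norm B * C"
    and t: "t \<ge> 0"
  obtains h where "h \<in> K" "act h p = p" "norm (h - mat 1 - t *\<^sub>R X) \<le> C * (t * norm X)\<^sup>2"
proof -
  define m where "m n = nat \<lfloor>t / e n\<rfloor>" for n
  have me: "(\<lambda>n. real (m n) * e n) \<longlonglongrightarrow> t"
  proof -
    have "\<bar>real (m n) * e n - t\<bar> \<le> e n" for n
    proof -
      have "real (m n) \<le> t / e n" "t / e n - 1 \<le> real (m n)"
        using t e(1)[of n] by (simp_all add: m_def)
      then show ?thesis
        using e(1)[of n] by (simp add: field_simps abs_le_iff)
    qed
    then have "(\<lambda>n. real (m n) * e n - t) \<longlonglongrightarrow> 0"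
      by (intro Lim_null_comparison[OF _ e(2)] always_eventually) simp
    then show ?thesis
      by (rule LIM_zero_cancel)
  qed
  obtain h r where h: "h \<in> K" "strict_mono r" "(\<lambda>n. matpow (g (r n)) (m (r n))) \<longlonglongrightarrow> h"
    by (rule compact_convergent_subseqE[OF compact, of "\<lambda>n. matpow (g n) (m n)"]) (simp add: g matpow_mem)
  note sub = LIMSEQ_subseq_LIMSEQ[OF _ h(2), unfolded o_def]
  have mX: "(\<lambda>n. (real (m n) * e n) *\<^sub>R ((g n - mat 1) /\<^sub>R e n)) \<longlonglongrightarrow> t *\<^sub>R X"
    by (intro tendsto_scaleR me X)
  have mX': "(real (m n) * e n) *\<^sub>R ((g n - mat 1) /\<^sub>R e n) = real (m n) *\<^sub>R (g n - mat 1)" for n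
    using e(1)[of n] by simp
  have "norm (h - mat 1 - t *\<^sub>R X) \<le> C * (norm (t *\<^sub>R X))\<^sup>2"
  proof (rule LIMSEQ_le)
    show "(\<lambda>n. norm (matpow (g (r n)) (m (r n)) - mat 1 - real (m (r n)) *\<^sub>R (g (r n) - mat 1)))
        \<longlonglongrightarrow> norm (h - mat 1 - t *\<^sub>R X)"
      using sub[OF mX] h(3) unfolding mX' by (intro tendsto_norm tendsto_diff tendsto_const)
    show "(\<lambda>n. C * (norm (real (m (r n)) *\<^sub>R (g (r n) - mat 1)))\<^sup>2) \<longlonglongrightarrow> C * (norm (t *\<^sub>R X))\<^sup>2"
      using sub[OF mX] unfolding mX' by (intro tendsto_mult tendsto_power tendsto_norm tendsto_const)
    show "\<exists>N. \<forall>n\<ge>N. norm (matpow (g (r n)) (m (r n)) - mat 1 - real (m (r n)) *\<^sub>R (g (r n) - mat 1))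
        \<le> C * (norm (real (m (r n)) *\<^sub>R (g (r n) - mat 1)))\<^sup>2"
      using norm_matpow_linear_approx[OF orth[OF g] C] by simp
  qed
  moreover have "act h p = p"
  proof -
    have "(\<lambda>n. norm (act (matpow (g (r n)) (m (r n))) p - p)) \<longlonglongrightarrow> 0"
    proof (rule tendsto_sandwich[OF _ _ tendsto_const])
      have "(\<lambda>n. (real (m n) * e n) * norm ((act (g n) p - p) /\<^sub>R e n)) \<longlonglongrightarrow> t * norm (0 :: pt5 \<times> mat5)"
        by (intro tendsto_mult me tendsto_norm p)
      moreover have "(real (m n) * e n) * norm ((act (g n) p - p) /\<^sub>R e n)
          = real (m n) * norm (act (g n) p - p)" for n
        using e(1)[of n] by simp
      ultimately have "(\<lambda>n. real (m n) * norm (act (g n) p - p)) \<longlonglongrightarrow> 0"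
        by (simp only: norm_zero mult_zero_right)
      then show "(\<lambda>n. real (m (r n)) * norm (act (g (r n)) p - p)) \<longlonglongrightarrow> 0"
        by (rule sub)
    qed (auto intro!: always_eventually norm_act_matpow orth g)
    moreover have "(\<lambda>n. norm (act (matpow (g (r n)) (m (r n))) p - p)) \<longlonglongrightarrow> norm (act h p - p)"
      by (intro tendsto_norm tendsto_diff tendsto_act h(3) tendsto_const)
    ultimately show ?thesis
      using LIMSEQ_unique by fastforce
  qed
  ultimately show thesis
    using that h(1) t by (simp add: power_mult_distrib)
qed

lemma limit_direction_skew:
  assumes g: "\<And>n. g n \<in> K" and e: "\<And>n. 0 < e n" "e \<longlonglongrightarrow> 0"
    and X: "(\<lambda>n. (g n - mat 1) /\<^sub>R e n) \<longlonglongrightarrow> X"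
  shows "g \<longlonglongrightarrow> mat 1" "transpose X = - X"
proof -
  have "(\<lambda>n. e n *\<^sub>R ((g n - mat 1) /\<^sub>R e n)) \<longlonglongrightarrow> 0 *\<^sub>R X"
    by (intro tendsto_scaleR e X)
  moreover have "e n *\<^sub>R ((g n - mat 1) /\<^sub>R e n) = g n - mat 1" for n
    using e(1)[of n] by simp
  ultimately show g1: "g \<longlonglongrightarrow> mat 1"
    using LIM_zero_cancel by fastforce
  \<comment> \<open>By g^T g = 1, the transposed quotient is minus \<open>transpose (g n)\<close>
    times the quotient; since \<open>g\<close> tends to the identity, the limit is skew.\<close>
  have "(\<lambda>n. - (transpose (g n) ** ((g n - mat 1) /\<^sub>R e n))) \<longlonglongrightarrow> - (transpose (mat 1) ** X)"
    by (intro tendsto_minus matmul.tendsto tendsto_transpose g1 X)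
  moreover have "- (transpose (g n) ** ((g n - mat 1) /\<^sub>R e n)) = transpose ((g n - mat 1) /\<^sub>R e n)" for n
    by (simp add: matmul.diff_right matmul.scaleR_right transpose_diff transpose_scaleR
        transpose_mult[OF g] transpose_mat flip: scaleR_minus_right)
  ultimately have "(\<lambda>n. transpose ((g n - mat 1) /\<^sub>R e n)) \<longlonglongrightarrow> - X"
    by (simp add: transpose_mat)
  then show "transpose X = - X"
    using LIMSEQ_unique tendsto_transpose[OF X] by blast
qed

text \<open>Negative times are served by the inverse \<open>transpose h\<close>: as \<open>X\<close>
  is skew, transposition exchanges the estimates at \<open>t\<close> and \<open>- t\<close>. Both
  signs are needed for two-sided curves, and negative times for correcting a lift.\<close>

lemma limit_direction:
  assumes g: "\<And>n. g n \<in> K" and e: "\<And>n. 0 < e n" "e \<longlonglongrightarrow> 0"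
    and X: "(\<lambda>n. (g n - mat 1) /\<^sub>R e n) \<longlonglongrightarrow> X"
    and p: "inf_act X p = 0"
  obtains D where "D \<ge> 0" "\<And>t. \<exists>h\<in>K. act h p = p \<and> norm (h - mat 1 - t *\<^sub>R X) \<le> D * t\<^sup>2"
proof -
  obtain C where C: "0 \<le> C" "\<And>(A :: mat5) (B :: mat5). norm (A ** B) \<le> norm A * norm B * C"
    using matmul.nonneg_bounded by blast
  note g1 = limit_direction_skew[OF g e X]
  have p0: "(\<lambda>n. (act (g n) p - p) /\<^sub>R e n) \<longlonglongrightarrow> 0"
    using tendsto_act_quotient[OF g1(1) X, of p] p by simp
  have "\<exists>h\<in>K. act h p = p \<and> norm (h - mat 1 - t *\<^sub>R X) \<le> C * (norm X)\<^sup>2 * t\<^sup>2" for t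
  proof (cases "t \<ge> 0")
    case True
    then show ?thesis
      using limit_direction_nonneg[OF g e X p0 C True] by (auto simp: power_mult_distrib mult_ac)
  next
    case False
    then obtain h where h: "h \<in> K" "act h p = p" "norm (h - mat 1 - (- t) *\<^sub>R X) \<le> C * ((- t) * norm X)\<^sup>2"
      using limit_direction_nonneg[OF g e X p0 C, of "- t"] by auto
    have "transpose (h - mat 1 - (- t) *\<^sub>R X) = transpose h - mat 1 - t *\<^sub>R X"
      by (simp add: transpose_diff transpose_scaleR transpose_mat g1(2)
          linear_add[OF bounded_linear.linear[OF bounded_linear_transpose]])
    then have "norm (transpose h - mat 1 - t *\<^sub>R X) \<le> C * ((- t) * norm X)\<^sup>2"
      using h(3) norm_transpose by metis
    moreover have "act (transpose h) p = p"
      by (metis act_mult act_one h(1,2) transpose_mult)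
    ultimately show ?thesis
      using transpose_mem[OF h(1)]
      by (intro bexI[of _ "transpose h"]) (auto simp: power_mult_distrib mult_ac)
  qed
  then show thesis
    using that[of "C * (norm X)\<^sup>2"] C(1) by simp
qed

lemma limit_direction_mem_lie_algebra:
  assumes g: "\<And>n. g n \<in> K" and e: "\<And>n. 0 < e n" "e \<longlonglongrightarrow> 0"
    and X: "(\<lambda>n. (g n - mat 1) /\<^sub>R e n) \<longlonglongrightarrow> X"
  shows "X \<in> lie_algebra"
proof -
  \<comment> \<open>At the point \<open>0\<close> the fixing condition is void and only the
    quadratic estimate remains. It forces \<open>h 0 = mat 1\<close> and makes \<open>X\<close> the
    velocity of \<open>h\<close> at 0.\<close>
  obtain D where D: "D \<ge> 0" "\<And>t. \<exists>h\<in>K. act h 0 = 0 \<and> norm (h - mat 1 - t *\<^sub>R X) \<le> D * t\<^sup>2"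
    using limit_direction[OF g e X, of 0] by (auto simp: inf_act_def matmul.zero_left matmul.zero_right zero_prod_def)
  then obtain h where h: "\<And>t. h t \<in> K" "\<And>t. norm (h t - mat 1 - t *\<^sub>R X) \<le> D * t\<^sup>2"
    by metis
  have h0: "h 0 = mat 1"
    using h(2)[of 0] by simp
  have "(h has_vector_derivative X) (at 0)"
    unfolding has_vector_derivative_at_0_iff
  proof (rule LIM_zero_cancel, rule tendsto_norm_zero_cancel, rule tendsto_sandwich[OF _ _ tendsto_const])
    show "\<forall>\<^sub>F t in at 0. norm ((h t - h 0) /\<^sub>R t - X) \<le> D * \<bar>t\<bar>"
      unfolding eventually_at_filter
    proof (intro always_eventually allI impI)
      fix t :: real assume t: "t \<noteq> 0"
      then have "(h t - h 0) /\<^sub>R t - X = (h t - mat 1 - t *\<^sub>R X) /\<^sub>R t"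
        by (simp add: scaleR_diff_right h0)
      then have "norm ((h t - h 0) /\<^sub>R t - X) = norm (h t - mat 1 - t *\<^sub>R X) / \<bar>t\<bar>"
        by (simp add: divide_inverse mult.commute)
      also have "\<dots> \<le> D * \<bar>t\<bar>"
        using h(2)[of t] t by (simp add: divide_le_eq power2_eq_square mult.assoc flip: abs_mult)
      finally show "norm ((h t - h 0) /\<^sub>R t - X) \<le> D * \<bar>t\<bar>" .
    qed
    show "((\<lambda>t. D * \<bar>t\<bar>) \<longlongrightarrow> 0) (at 0)"
      by (auto intro!: tendsto_eq_intros)
  qed simp
  then show ?thesis
    using h(1) h0 lie_algebraI by blast
qed

lemma inf_act_mem_tangent_vecs:
  assumes "X \<in> lie_algebra"
  shows "inf_act X p \<in> tangent_vecs (orbit K p) p"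
proof -
  obtain h where h: "\<And>t::real. h t \<in> K" "h 0 = mat 1" "(h has_vector_derivative X) (at 0)"
    using assms by (metis lie_algebraE)
  have "(h \<longlongrightarrow> mat 1) (at 0)"
    using has_vector_derivative_continuous[OF h(3)] h(2) by (simp add: continuous_within)
  from tendsto_act_quotient[OF this] h(3)
  have "((\<lambda>t. act (h t) p) has_vector_derivative inf_act X p) (at 0)"
    by (simp add: has_vector_derivative_at_0_iff h(2))
  then show ?thesis
    unfolding tangent_vecs_def orbit_def
    by (auto intro!: exI[of _ "\<lambda>t. act (h t) p"] simp: h)
qed

text \<open>A curve in the orbit is lifted pointwise to group elements as close to the identity as
  possible.  Were their distance to the identity not comparable to the parameter, a limit
  direction would fix \<^term>\<open>p\<close>, and moving along it inside the stabiliser would produce a closer lift.\<close>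

lemma tangent_vecs_subset_inf_act:
  assumes "v \<in> tangent_vecs (orbit K p) p"
  shows "v \<in> (\<lambda>X. inf_act X p) ` lie_algebra"
proof -
  obtain c where c: "\<And>t. c t \<in> orbit K p" "c 0 = p" "(c has_vector_derivative v) (at 0)"
    using assms unfolding tangent_vecs_def by blast
  define s where "s n = 1 / real (Suc n)" for n
  have s0: "s n > 0" for n by (simp add: s_def)
  have s_lim: "s \<longlonglongrightarrow> 0"
    unfolding s_def by (rule LIMSEQ_Suc[OF lim_1_over_n])
  have cont: "continuous_on UNIV (\<lambda>g. act g p)"
    by (simp add: continuous_on_def tendsto_act)
  have "\<exists>g\<in>K. act g p = c t \<and> (\<forall>g'\<in>K. act g' p = c t \<longrightarrow> norm (g - mat 1) \<le> norm (g' - mat 1))" for t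
  proof -
    have "closed {g. act g p = c t}"
      by (intro closed_Collect_eq cont continuous_on_const)
    then have "compact (K \<inter> {g. act g p = c t})"
      using compact by (rule compact_Int_closed[rotated])
    moreover have "K \<inter> {g. act g p = c t} \<noteq> {}"
      using c(1)[of t] by (force simp: orbit_def)
    moreover have "continuous_on (K \<inter> {g. act g p = c t}) (\<lambda>g. norm (g - mat 1))"
      by (intro continuous_intros)
    ultimately have "\<exists>g\<in>K \<inter> {g. act g p = c t}. \<forall>g'\<in>K \<inter> {g. act g p = c t}. norm (g - mat 1) \<le> norm (g' - mat 1)"
      by (rule continuous_attains_inf)
    then show ?thesis by auto
  qed
  then obtain g where g: "\<And>t. g t \<in> K" "\<And>t. act (g t) p = c t"
    "\<And>t g'. g' \<in> K \<Longrightarrow> act g' p = c t \<Longrightarrow> norm (g t - mat 1) \<le> norm (g' - mat 1)"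
    by metis
  obtain ginf r1 where r1: "ginf \<in> K" "strict_mono r1" "(\<lambda>n. g (s (r1 n))) \<longlonglongrightarrow> ginf"
    by (rule compact_convergent_subseqE[OF compact, of "\<lambda>n. g (s n)"]) (simp add: g(1))
  have c_lim: "(\<lambda>n. c (x n)) \<longlonglongrightarrow> p" if "x \<longlonglongrightarrow> 0" for x
    using isCont_tendsto_compose[OF has_vector_derivative_continuous[OF c(3)] that] c(2) by simp
  have s1: "(\<lambda>n. s (r1 n)) \<longlonglongrightarrow> 0"
    using LIMSEQ_subseq_LIMSEQ[OF s_lim r1(2)] by (simp add: o_def)
  have "act ginf p = p"
    using LIMSEQ_unique[OF tendsto_act[OF r1(3), of p]] c_lim[OF s1] by (simp add: g(2))
  then have stab: "act (transpose ginf) p = p"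
    by (metis act_mult act_one r1(1) transpose_mult)
  \<comment> \<open>The limit \<open>ginf\<close> fixes \<open>p\<close>, so multiplying by its
    inverse gives other lifts of the same points, which tend to the identity. By minimality the
    chosen lifts do so too.\<close>
  have "(\<lambda>n. norm (g (s (r1 n)) - mat 1)) \<longlonglongrightarrow> 0"
  proof (rule tendsto_sandwich[OF _ _ tendsto_const])
    have "(\<lambda>n. norm (g (s (r1 n)) ** transpose ginf - mat 1)) \<longlonglongrightarrow> norm (ginf ** transpose ginf - mat 1)"
      by (intro tendsto_norm tendsto_diff matmul.tendsto r1(3) tendsto_const)
    then show "(\<lambda>n. norm (g (s (r1 n)) ** transpose ginf - mat 1)) \<longlonglongrightarrow> 0"
      by (simp add: mult_transpose r1(1))
    show "\<forall>\<^sub>F n in sequentially. norm (g (s (r1 n)) - mat 1) \<le> norm (g (s (r1 n)) ** transpose ginf - mat 1)"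
      by (intro always_eventually allI g(3)) (auto simp: mult_mem transpose_mem g r1(1) act_mult stab)
  qed simp
  then have e1: "(\<lambda>n. max (norm (g (s (r1 n)) - mat 1)) (s (r1 n))) \<longlonglongrightarrow> 0"
    using tendsto_max[OF _ s1] by fastforce
  \<comment> \<open>A common scale for the displacement of the lift and the parameter: both
    quotients stay in a compact set, and the limit \<open>tau\<close> of the second vanishes exactly
    if the displacement dominates.\<close>
  define e where "e x = max (norm (g x - mat 1)) x" for x :: real
  have "compact (cball (0::mat5) 1 \<times> {0..1::real})"
    by (intro compact_Times) auto
  moreover have "((g (s (r1 n)) - mat 1) /\<^sub>R e (s (r1 n)), s (r1 n) / e (s (r1 n))) \<in> cball 0 1 \<times> {0..1}" for n
  proof -
    have "norm (g (s (r1 n)) - mat 1) \<le> e (s (r1 n))" "s (r1 n) \<le> e (s (r1 n))" "0 < e (s (r1 n))"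
      using s0[of "r1 n"] by (auto simp: e_def)
    then show ?thesis
      using s0[of "r1 n"] by (simp add: divide_le_eq inverse_eq_divide)
  qed
  ultimately obtain Y r2 where r2: "strict_mono r2"
    "(\<lambda>n. ((g (s (r1 (r2 n))) - mat 1) /\<^sub>R e (s (r1 (r2 n))), s (r1 (r2 n)) / e (s (r1 (r2 n))))) \<longlonglongrightarrow> Y"
    by (rule compact_convergent_subseqE)
  obtain X tau where Y: "Y = (X, tau)" by fastforce
  define x where "x n = s (r1 (r2 n))" for n
  have x0: "x n > 0" for n by (simp add: x_def s0)
  have xlim: "x \<longlonglongrightarrow> 0" "(\<lambda>n. e (x n)) \<longlonglongrightarrow> 0"
    using LIMSEQ_subseq_LIMSEQ[OF s1 r2(1)] LIMSEQ_subseq_LIMSEQ[OF e1 r2(1)]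
    unfolding x_def[abs_def] by (simp_all add: o_def e_def)
  have ex0: "e (x n) > 0" for n
    using x0[of n] by (simp add: e_def)
  have X: "(\<lambda>n. (g (x n) - mat 1) /\<^sub>R e (x n)) \<longlonglongrightarrow> X" and tau: "(\<lambda>n. x n / e (x n)) \<longlonglongrightarrow> tau"
    using tendsto_fst[OF r2(2)] tendsto_snd[OF r2(2)] by (simp_all add: Y x_def)
  note dir = limit_direction_skew[OF g(1) ex0 xlim(2) X]
  have Xmem: "X \<in> lie_algebra"
    by (rule limit_direction_mem_lie_algebra[OF g(1) ex0 xlim(2) X])
  have Xp: "inf_act X p = tau *\<^sub>R v"
  proof (rule LIMSEQ_unique)
    show "(\<lambda>n. (act (g (x n)) p - p) /\<^sub>R e (x n)) \<longlonglongrightarrow> inf_act X p"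
      by (rule tendsto_act_quotient[OF dir(1) X])
    have "filterlim x (at 0) sequentially"
      using xlim(1) x0 by (simp add: filterlim_at less_imp_neq[symmetric] always_eventually)
    then have "(\<lambda>n. (c (x n) - c 0) /\<^sub>R x n) \<longlonglongrightarrow> v"
      using c(3) unfolding has_vector_derivative_at_0_iff by (rule filterlim_compose[rotated])
    then have "(\<lambda>n. (x n / e (x n)) *\<^sub>R ((c (x n) - c 0) /\<^sub>R x n)) \<longlonglongrightarrow> tau *\<^sub>R v"
      by (intro tendsto_scaleR tau)
    moreover have "(x n / e (x n)) *\<^sub>R ((c (x n) - c 0) /\<^sub>R x n) = (act (g (x n)) p - p) /\<^sub>R e (x n)" for n
      using x0[of n] by (simp add: g(2) c(2) divide_inverse)
    ultimately show "(\<lambda>n. (act (g (x n)) p - p) /\<^sub>R e (x n)) \<longlonglongrightarrow> tau *\<^sub>R v"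
      by simp
  qed
  have "tau \<noteq> 0"
  proof
    assume t0: "tau = 0"
    obtain D where D: "D \<ge> 0" "\<And>t. \<exists>h\<in>K. act h p = p \<and> norm (h - mat 1 - t *\<^sub>R X) \<le> D * t\<^sup>2"
      using limit_direction[OF g(1) ex0 xlim(2) X, of p] Xp t0 by auto
    \<comment> \<open>If the ratio is below 1, the maximum in \<open>e\<close> is not attained by
      the parameter, so \<open>e (x n)\<close> is the distance of the lift from the
      identity.\<close>
    have bound: "1 \<le> D * e (x n) + norm ((g (x n) - mat 1) /\<^sub>R e (x n) - X)" if "x n / e (x n) < 1" for n
    proof -
      define G \<epsilon> where "G = g (x n)" and "\<epsilon> = e (x n)"
      have eps: "\<epsilon> > 0" "norm (G - mat 1) = \<epsilon>"
        using ex0[of n] that unfolding \<epsilon>_def G_def by (auto simp: e_def max_def split: if_splits)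
      obtain h where h: "h \<in> K" "act h p = p" "norm (h - mat 1 - (- \<epsilon>) *\<^sub>R X) \<le> D * (- \<epsilon>)\<^sup>2"
        using D(2)[of "- \<epsilon>"] by blast
      \<comment> \<open>As \<open>h\<close> fixes \<open>p\<close>, \<open>G ** h\<close> is a
        competing lift. Both \<open>h\<close> and \<open>transpose G\<close> approximate
        \<open>mat 1 - \<epsilon> *\<^sub>R X\<close> to first order, so its distance from the
        identity is small compared with \<epsilon>.\<close>
      have "\<epsilon> \<le> norm (G ** h - mat 1)"
        unfolding eps(2)[symmetric] G_def by (rule g(3)) (auto simp: g h mult_mem act_mult)
      also have "G ** h - mat 1 = G ** (h - transpose G)"
        by (simp add: matmul.diff_right mult_transpose g(1) G_def)
      also have "norm \<dots> = norm (h - transpose G)"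
        using norm_orthogonal_matrix_mult orth g(1) G_def by blast
      also have "h - transpose G = (h - mat 1 - (- \<epsilon>) *\<^sub>R X) - transpose (G - mat 1 - \<epsilon> *\<^sub>R X)"
        by (simp add: transpose_diff transpose_scaleR transpose_mat dir(2))
      also have "norm \<dots> \<le> norm (h - mat 1 - (- \<epsilon>) *\<^sub>R X) + norm (G - mat 1 - \<epsilon> *\<^sub>R X)"
        by (metis norm_transpose norm_triangle_ineq4)
      also have "\<dots> \<le> D * \<epsilon>\<^sup>2 + norm (G - mat 1 - \<epsilon> *\<^sub>R X)"
        using h(3) by simp
      also have "G - mat 1 - \<epsilon> *\<^sub>R X = \<epsilon> *\<^sub>R ((G - mat 1) /\<^sub>R \<epsilon> - X)"
        using eps(1) by (simp add: scaleR_diff_right)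
      also have "D * \<epsilon>\<^sup>2 + norm \<dots> = \<epsilon> * (D * \<epsilon> + norm ((G - mat 1) /\<^sub>R \<epsilon> - X))"
        using eps(1) by (simp add: power2_eq_square distrib_left mult.left_commute)
      finally show ?thesis
        using eps(1) by (simp add: G_def \<epsilon>_def)
    qed
    have "(\<lambda>n. D * e (x n) + norm ((g (x n) - mat 1) /\<^sub>R e (x n) - X)) \<longlonglongrightarrow> D * 0 + norm (X - X)"
      by (intro tendsto_intros xlim(2) X)
    moreover have "\<forall>\<^sub>F n in sequentially. x n / e (x n) < 1"
      using order_tendstoD(2)[OF tau, of 1] t0 by simp
    then have "\<forall>\<^sub>F n in sequentially. 1 \<le> D * e (x n) + norm ((g (x n) - mat 1) /\<^sub>R e (x n) - X)"
      by (rule eventually_mono) (rule bound)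
    ultimately have "1 \<le> D * 0 + norm (X - X)"
      by (rule tendsto_lowerbound) simp
    then show False by simp
  qed
  then have "v = inf_act (X /\<^sub>R tau) p"
    using Xp by (simp add: linear_scale[OF linear_inf_act])
  then show ?thesis
    using subspace_scale[OF subspace_lie_algebra Xmem] by blast
qed

lemma tangent_vecs_orbit: "tangent_vecs (orbit K p) p = (\<lambda>X. inf_act X p) ` lie_algebra"
  using inf_act_mem_tangent_vecs tangent_vecs_subset_inf_act by blast

end

section \<open>Anti-self-dual forms\<close>

lemma det5_swap:
  "det5 b a c d e = - det5 a b c d e" "det5 a c b d e = - det5 a b c d e"
  "det5 a b d c e = - det5 a b c d e" "det5 a b c e d = - det5 a b c d e"
proof -
  define A :: mat5 where "A = (\<chi> r. if r = 1 then a else if r = 2 then b else if r = 3 then c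
                              else if r = 4 then d else e)"
  have swap: "det (\<chi> i. A $ Transposition.transpose m n i) = - det A" if "m \<noteq> n" for m n
    using that by (subst det_permute_rows) (auto simp: permutes_swap_id sign_swap_id)
  have "(\<chi> i. A $ Transposition.transpose 1 2 i) = (\<chi> r. if r = 1 then b else if r = 2 then a
      else if r = 3 then c else if r = 4 then d else e)"
    unfolding vec_eq_iff[where 'b=5 and 'a="real^5"] forall_5 by (simp add: A_def Transposition.transpose_def)
  then show "det5 b a c d e = - det5 a b c d e"
    using swap[of 1 2] by (simp add: det5_def A_def)
  have "(\<chi> i. A $ Transposition.transpose 2 3 i) = (\<chi> r. if r = 1 then a else if r = 2 then c
      else if r = 3 then b else if r = 4 then d else e)"
    unfolding vec_eq_iff[where 'b=5 and 'a="real^5"] forall_5 by (simp add: A_def Transposition.transpose_def)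
  then show "det5 a c b d e = - det5 a b c d e"
    using swap[of 2 3] by (simp add: det5_def A_def)
  have "(\<chi> i. A $ Transposition.transpose 3 4 i) = (\<chi> r. if r = 1 then a else if r = 2 then b
      else if r = 3 then d else if r = 4 then c else e)"
    unfolding vec_eq_iff[where 'b=5 and 'a="real^5"] forall_5 by (simp add: A_def Transposition.transpose_def)
  then show "det5 a b d c e = - det5 a b c d e"
    using swap[of 3 4] by (simp add: det5_def A_def)
  have "(\<chi> i. A $ Transposition.transpose 4 5 i) = (\<chi> r. if r = 1 then a else if r = 2 then b
      else if r = 3 then c else if r = 4 then e else d)"
    unfolding vec_eq_iff[where 'b=5 and 'a="real^5"] forall_5 by (simp add: A_def Transposition.transpose_def)
  then show "det5 a b c e d = - det5 a b c d e"
    using swap[of 4 5] by (simp add: det5_def A_def)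
qed

lemma det5_repeat:
  "det5 a a c d e = 0" "det5 a b b d e = 0" "det5 a b c c e = 0" "det5 a b c d d = 0"
  using det5_swap(1)[of a a] det5_swap(2)[of a b b] det5_swap(3)[of a b c c] det5_swap(4)[of a b c d d]
  by simp_all

lemma det5_expand: "det5 x b c d e = (\<Sum>l\<in>UNIV. x$l * det5 (axis l 1) b c d e)"
proof -
  define R :: "5 \<Rightarrow> pt5" where "R r = (if r = 2 then b else if r = 3 then c else if r = 4 then d else e)" for r
  have R: "det5 y b c d e = det (\<chi> r. if r = 1 then y else R r)" for y
    unfolding det5_def R_def by (rule arg_cong[where f=det]) (simp add: vec_eq_iff)
  have x: "x = (\<Sum>l\<in>UNIV. x$l *s axis l 1)"
    by (simp add: basis_expansion)
  show ?thesis
    unfolding R by (subst x) (simp add: det_linear_row_sum det_row_mul)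
qed

text \<open>In the type \<open>5\<close> the numeral \<open>5\<close> equals \<open>0\<close> and is the least element, so its order cannot be
  used to sort indices.\<close>

definition idx5 :: "5 \<Rightarrow> nat" where
  "idx5 i = (if i = 1 then 1 else if i = 2 then 2 else if i = 3 then 3 else if i = 4 then 4 else 5)"

lemma idx5_simps: "idx5 1 = 1" "idx5 2 = 2" "idx5 3 = 3" "idx5 4 = 4" "idx5 5 = 5"
  by (simp_all add: idx5_def)

lemma det5_axis_sort:
  "idx5 j < idx5 i \<Longrightarrow> det5 a (axis i 1) (axis j 1) d e = - det5 a (axis j 1) (axis i 1) d e"
  "idx5 j < idx5 i \<Longrightarrow> det5 a b (axis i 1) (axis j 1) e = - det5 a b (axis j 1) (axis i 1) e"
  "idx5 j < idx5 i \<Longrightarrow> det5 a b c (axis i 1) (axis j 1) = - det5 a b c (axis j 1) (axis i 1)"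
  by (rule det5_swap)+

lemma det5_axis_id: "det5 (axis 1 1) (axis 2 1) (axis 3 1) (axis 4 1) (axis 5 1) = 1"
proof -
  have "(\<chi> r. if r = 1 then axis 1 1 else if r = 2 then axis 2 1 else if r = 3 then axis 3 1
      else if r = 4 then axis 4 1 else axis 5 1) = (mat 1 :: mat5)"
    unfolding vec_eq_iff forall_5 by (simp add: mat_def axis_def)
  then show ?thesis
    by (simp add: det5_def)
qed

lemma det5_axis:
  "det5 x (axis 2 1) (axis 3 1) (axis 4 1) (axis 5 1) = x $ 1"
  "det5 x (axis 1 1) (axis 3 1) (axis 4 1) (axis 5 1) = - x $ 2"
  "det5 x (axis 1 1) (axis 2 1) (axis 4 1) (axis 5 1) = x $ 3"
  "det5 x (axis 1 1) (axis 2 1) (axis 3 1) (axis 5 1) = - x $ 4"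
  "det5 x (axis 1 1) (axis 2 1) (axis 3 1) (axis 4 1) = x $ 5"
proof -
  note sw1 = det5_swap(1)[of _ "axis 1 1"] and sw2 = det5_swap(2)[of _ _ "axis 2 1"]
    and sw3 = det5_swap(3)[of _ _ _ "axis 3 1"] and sw4 = det5_swap(4)[of _ _ _ _ "axis 4 1"]
  have z1: "det5 a b a d e = 0" for a b d e
    using det5_swap(2)[of a b a d e] by (simp add: det5_repeat)
  have z2: "det5 a b c a e = 0" for a b c e
    using det5_swap(3)[of a b c a e] by (simp add: z1)
  have "det5 a b c d a = 0" for a b c d
    using det5_swap(4)[of a b c d a] by (simp add: z2)
  note z = z1 z2 this
  show "det5 x (axis 2 1) (axis 3 1) (axis 4 1) (axis 5 1) = x $ 1"
    by (subst det5_expand) (simp add: sum_5 z det5_repeat det5_axis_id)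
  show "det5 x (axis 1 1) (axis 3 1) (axis 4 1) (axis 5 1) = - x $ 2"
    by (subst det5_expand) (simp add: sum_5 z det5_repeat sw1[of "axis 2 1"] det5_axis_id)
  show "det5 x (axis 1 1) (axis 2 1) (axis 4 1) (axis 5 1) = x $ 3"
    by (subst det5_expand) (simp add: sum_5 z det5_repeat sw1[of "axis 3 1"] sw2[of _ "axis 3 1"] det5_axis_id)
  show "det5 x (axis 1 1) (axis 2 1) (axis 3 1) (axis 5 1) = - x $ 4"
    by (subst det5_expand) (simp add: sum_5 z det5_repeat sw1[of "axis 4 1"] sw2[of _ "axis 4 1"]
        sw3[of _ _ "axis 4 1"] det5_axis_id)
  show "det5 x (axis 1 1) (axis 2 1) (axis 3 1) (axis 4 1) = x $ 5"
    by (subst det5_expand) (simp add: sum_5 z det5_repeat sw1[of "axis 5 1"] sw2[of _ "axis 5 1"]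
        sw3[of _ _ "axis 5 1"] sw4[of _ _ _ "axis 5 1"] det5_axis_id)
qed

lemma hodge_skew: "hodge x M $ k $ j = - hodge x M $ j $ k"
  unfolding hodge_def by (simp add: det5_swap(2)[of x "axis k 1" "axis j 1"] sum_negf)

lemma hodge_entries:
  assumes "transpose M = - M"
  shows 
    "hodge x M $ 1 $ 2 = x$3 * M$4$5 - x$4 * M$3$5 + x$5 * M$3$4" 
    "hodge x M $ 1 $ 3 = - x$2 * M$4$5 + x$4 * M$2$5 - x$5 * M$2$4" 
    "hodge x M $ 1 $ 4 = x$2 * M$3$5 - x$3 * M$2$5 + x$5 * M$2$3" 
    "hodge x M $ 1 $ 5 = - x$2 * M$3$4 + x$3 * M$2$4 - x$4 * M$2$3" 
    "hodge x M $ 2 $ 3 = x$1 * M$4$5 - x$4 * M$1$5 + x$5 * M$1$4" 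
    "hodge x M $ 2 $ 4 = - x$1 * M$3$5 + x$3 * M$1$5 - x$5 * M$1$3" 
    "hodge x M $ 2 $ 5 = x$1 * M$3$4 - x$3 * M$1$4 + x$4 * M$1$3" 
    "hodge x M $ 3 $ 4 = x$1 * M$2$5 - x$2 * M$1$5 + x$5 * M$1$2" 
    "hodge x M $ 3 $ 5 = - x$1 * M$2$4 + x$2 * M$1$4 - x$4 * M$1$2" 
    "hodge x M $ 4 $ 5 = x$1 * M$2$3 - x$2 * M$1$3 + x$3 * M$1$2"
  unfolding hodge_def
  by (simp_all add: sum_5 det5_repeat det5_axis_sort det5_axis idx5_simps skew_entries[OF assms])

text \<open>Component l is (-1)^(l+1) times the Pfaffian of \<open>M\<close> with row and column l
  deleted; the vector is dual to the 4-form obtained as half the wedge square of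
  \<open>M\<close>.\<close>

definition pfaffian_vector :: "mat5 \<Rightarrow> pt5" where
  "pfaffian_vector M = (\<chi> l.
     if l = 1 then M$2$3 * M$4$5 - M$2$4 * M$3$5 + M$2$5 * M$3$4
     else if l = 2 then - (M$1$3 * M$4$5 - M$1$4 * M$3$5 + M$1$5 * M$3$4)
     else if l = 3 then M$1$2 * M$4$5 - M$1$4 * M$2$5 + M$1$5 * M$2$4
     else if l = 4 then - (M$1$2 * M$3$5 - M$1$3 * M$2$5 + M$1$5 * M$2$3)
     else M$1$2 * M$3$4 - M$1$3 * M$2$4 + M$1$4 * M$2$3)"

text \<open>A Pfaffian counterpart of multiplying a matrix by its adjugate. For
  \<open>x = axis 5 1\<close> and \<open>M\<close> in so(4) it says that M times its Hodge dual is
  -Pf(M) on R^4. The general identity is polynomial and is checked entrywise.\<close>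

lemma mult_hodge:
  assumes "transpose M = - M"
  shows "(M ** hodge x M) $ i $ k = x $ i * pfaffian_vector M $ k
    - (if i = k then x \<bullet> pfaffian_vector M else 0)"
proof -
  have h0: "hodge x M $ i $ i = 0" for i
    using hodge_skew[of x M i i] by simp
  note h = hodge_entries[OF assms, of x]
  have h': "hodge x M $ 2 $ 1 = - hodge x M $ 1 $ 2" "hodge x M $ 3 $ 1 = - hodge x M $ 1 $ 3"
    "hodge x M $ 4 $ 1 = - hodge x M $ 1 $ 4" "hodge x M $ 5 $ 1 = - hodge x M $ 1 $ 5"
    "hodge x M $ 3 $ 2 = - hodge x M $ 2 $ 3" "hodge x M $ 4 $ 2 = - hodge x M $ 2 $ 4"
    "hodge x M $ 5 $ 2 = - hodge x M $ 2 $ 5" "hodge x M $ 4 $ 3 = - hodge x M $ 3 $ 4"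
    "hodge x M $ 5 $ 3 = - hodge x M $ 3 $ 5" "hodge x M $ 5 $ 4 = - hodge x M $ 4 $ 5"
    by (rule hodge_skew)+
  have "\<forall>i k. (M ** hodge x M) $ i $ k = x $ i * pfaffian_vector M $ k
    - (if i = k then x \<bullet> pfaffian_vector M else 0)"
    unfolding forall_5
    by (simp add: matrix_matrix_mult_def inner_vec_def sum_5 h0 h h' skew_entries[OF assms] pfaffian_vector_def)
       (simp add: algebra_simps)
  then show ?thesis by blast
qed

text \<open>The square of a skew matrix is symmetric, hence the Pfaffian vector is parallel to \<open>x\<close>.\<close>

lemma ASD_square:
  assumes "transpose A = - A" "hodge x A = - A" "norm x = 1"
  shows "A ** A = - (frob A A / 4) *\<^sub>R proj_tan x"
proof -
  define q where "q = pfaffian_vector A"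
  have sq: "(A ** A) $ i $ k = (if i = k then x \<bullet> q else 0) - x $ i * q $ k" for i k
    using mult_hodge[OF assms(1), of x i k]
    by (cases "i = k"; simp add: q_def matmul.minus_right assms(2); linarith)
  have "transpose (A ** A) = A ** A"
    by (simp add: matrix_transpose_mul assms(1) matmul.minus_right matmul.minus_left)
  then have sym: "(A ** A) $ i $ k = (A ** A) $ k $ i" for i k
    by (drule_tac arg_cong[where f="\<lambda>M. M $ k $ i"]) (simp add: transpose_def)
  have xx: "x \<bullet> x = 1"
    using assms(3) by (simp add: norm_eq_1)
  have xq: "x $ i * q $ k = x $ k * q $ i" for i k
    using sym[of i k] by (simp add: sq split: if_splits)
  have "q = (x \<bullet> q) *\<^sub>R x"
  proof -
    have "q $ k = (x \<bullet> q) * x $ k" for k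
    proof -
      have "q $ k = (\<Sum>i\<in>UNIV. x $ i * x $ i) * q $ k"
        using xx by (simp add: inner_vec_def)
      also have "\<dots> = (\<Sum>i\<in>UNIV. x $ i * (x $ i * q $ k))"
        by (simp add: sum_distrib_right mult.assoc)
      also have "\<dots> = (\<Sum>i\<in>UNIV. x $ i * (x $ k * q $ i))"
        by (simp only: xq)
      also have "\<dots> = (x \<bullet> q) * x $ k"
        by (simp add: inner_vec_def sum_distrib_left mult_ac)
      finally show ?thesis .
    qed
    then show ?thesis by (simp add: vec_eq_iff)
  qed
  then have q: "q $ k = (x \<bullet> q) * x $ k" for k
    by (metis real_scaleR_def vector_scaleR_component)
  have sq': "A ** A = (x \<bullet> q) *\<^sub>R proj_tan x"
    unfolding vec_eq_iff
  proof (intro allI)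
    fix i k
    show "(A ** A) $ i $ k = ((x \<bullet> q) *\<^sub>R proj_tan x) $ i $ k"
      using q[of k] by (simp add: sq proj_tan_def mat_def algebra_simps)
  qed
  \<comment> \<open>Taking traces identifies the factor: \<open>proj_tan x\<close> has trace
    4.\<close>
  have "frob A A = - (\<Sum>i\<in>UNIV. (A ** A) $ i $ i)"
    by (simp add: frob_def matrix_matrix_mult_def sum_5 skew_entries[OF assms(1)])
  also have "\<dots> = - 4 * (x \<bullet> q)"
    using xx by (simp add: sq sum_subtractf) (simp add: inner_vec_def)
  finally show ?thesis
    using sq' by simp
qed

section \<open>Equivariance and normal form\<close>

lemma inner_skew_matrix:
  assumes "transpose A = - A"
  shows "(A *v v) \<bullet> w = - (v \<bullet> (A *v (w :: real^'n)))"
proof -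
  have "v v* A = - (A *v v)"
    using assms by (metis matvec.minus_left transpose_matrix_vector)
  then show ?thesis
    using dot_lmul_matrix[of v A w] by simp
qed

definition outer :: "real^'n \<Rightarrow> real^'m \<Rightarrow> real^'m^'n" where
  "outer x y = (\<chi> i j. x $ i * y $ j)"

lemma proj_tan_eq: "proj_tan x = mat 1 - outer x x"
  by (simp add: proj_tan_def outer_def)

lemma matrix_mult_outer: "g ** outer x y = outer (g *v x) y"
  and outer_matrix_mult: "outer x y ** transpose g = outer x (g *v y)"
  by (simp_all add: outer_def vec_eq_iff matrix_matrix_mult_def matrix_vector_mult_def transpose_def
      sum_distrib_left sum_distrib_right mult_ac)

lemma outer_matrix_vector: "outer x y *v z = (y \<bullet> z) *\<^sub>R x"
  by (simp add: outer_def vec_eq_iff matrix_vector_mult_def inner_vec_def sum_distrib_left mult_ac)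

lemma proj_tan_orthogonal:
  assumes "orthogonal_matrix g"
  shows "proj_tan (g *v x) = g ** proj_tan x ** transpose g"
  using assms
  by (simp add: proj_tan_eq matmul.diff_left matmul.diff_right matrix_mult_outer outer_matrix_mult
      orthogonal_matrix_def)

lemma conj_mult:
  assumes "orthogonal_matrix g"
  shows "(g ** M ** transpose g) ** (g ** N ** transpose g) = g ** (M ** N) ** transpose g"
proof -
  have "(g ** M ** transpose g) ** (g ** N ** transpose g) = g ** M ** (transpose g ** g) ** N ** transpose g"
    by (simp only: matrix_mul_assoc)
  also have "\<dots> = g ** M ** N ** transpose g"
    using assms by (simp add: orthogonal_matrix_def)
  finally show ?thesis
    by (simp only: matrix_mul_assoc)
qed

lemma conj_vector:
  assumes "orthogonal_matrix g"
  shows "(g ** M ** transpose g) *v (g *v x) = g *v (M *v x)"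
proof -
  have "(g ** M ** transpose g) *v (g *v x) = (g ** M ** (transpose g ** g)) *v x"
    by (simp only: matrix_vector_mul_assoc matrix_mul_assoc)
  then show ?thesis
    using assms by (simp add: orthogonal_matrix_def matrix_vector_mul_assoc)
qed

lemma inner_orthogonal_matrix:
  assumes "orthogonal_matrix g"
  shows "(g *v x) \<bullet> (g *v y) = x \<bullet> (y :: real^'n)"
proof -
  have "(g *v x) \<bullet> (g *v y) = (transpose g *v (g *v x)) \<bullet> y"
    by (simp add: dot_lmul_matrix)
  also have "\<dots> = x \<bullet> y"
    using assms by (simp only: matrix_vector_mul_assoc orthogonal_matrix_def matrix_vector_mul_lid)
  finally show ?thesis .
qed

lemma transpose_conj:
  "transpose (g ** M ** transpose g) = g ** transpose M ** transpose (g :: real^'n^'n)"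
  by (simp add: matrix_transpose_mul matrix_mul_assoc)

lemma frob_conj:
  assumes "orthogonal_matrix g"
  shows "frob (g ** M ** transpose g) (g ** N ** transpose g) = frob M N"
proof -
  have tr: "frob M N = trace (transpose M ** N)" for M N
    unfolding frob_def trace_def matrix_matrix_mult_def transpose_def by simp (rule sum.swap)
  have "trace (g ** Y ** transpose g) = trace Y" for Y
    by (subst trace_mul_sym) (use assms in \<open>simp add: matrix_mul_assoc orthogonal_matrix_def\<close>)
  then show ?thesis
    by (simp add: tr transpose_conj conj_mult[OF assms])
qed

text \<open>All ingredients of \<open>phi\<close> are inner products, traces and products that
  commute with conjugation. No determinant enters, so the invariance extends to
  orientation-reversing matrices, which the normal form requires.\<close>

lemma phi_act:
  assumes g: "orthogonal_matrix g"
  shows "phi lam (act g p) (act g u1) (act g u2) (act g u3) = phi lam p u1 u2 u3"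
proof -
  have vert: "proj_tan (g *v fst p) ** (g ** C ** transpose g) ** proj_tan (g *v fst p)
      = g ** (proj_tan (fst p) ** C ** proj_tan (fst p)) ** transpose g" for C
    by (simp only: proj_tan_orthogonal[OF g] conj_mult[OF g])
  have diff: "g ** M ** transpose g - g ** N ** transpose g = g ** (M - N) ** transpose g" for M N
    by (simp add: matmul.diff_left matmul.diff_right)
  show ?thesis
    by (simp only: phi_def Let_def act_def fst_conv snd_conv vert vol_V_def conj_mult[OF g] diff
        frob_conj[OF g] conj_vector[OF g] inner_orthogonal_matrix[OF g])
qed

lemma inf_act_conj:
  assumes g: "orthogonal_matrix g"
  shows "inf_act (g ** X ** transpose g) (act g p) = act g (inf_act X p)"
  by (simp add: inf_act_def act_def conj_vector[OF g] transpose_conj conj_mult[OF g]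
      matmul.add_left matmul.add_right)

section \<open>Normal form of a non-zero point and the 3-form there\<close>

definition std_J :: mat5 where
  "std_J = (\<chi> i j. if (i = 2 \<and> j = 1) \<or> (i = 4 \<and> j = 3) then 1
     else if (i = 1 \<and> j = 2) \<or> (i = 3 \<and> j = 4) then - 1 else 0)"

lemma unit_vector_orthogonal:
  fixes S :: "pt5 set"
  assumes "finite S" "card S < 5"
  obtains v where "norm v = 1" "\<And>y. y \<in> S \<Longrightarrow> v \<bullet> y = 0"
proof -
  have "dim S < DIM(pt5)"
    using dim_le_card'[OF assms(1)] assms(2) by simp
  then obtain v where v: "v \<noteq> 0" "\<And>y. y \<in> span S \<Longrightarrow> orthogonal v y"
    using orthogonal_to_subspace_exists by metis
  show thesis
    by (rule that[of "v /\<^sub>R norm v"]) (use v in \<open>auto simp: orthogonal_def span_base\<close>)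
qed

text \<open>By \<open>ASD_square\<close>, A / \<rho> is a complex structure on the orthogonal
  complement of \<open>x\<close>, so a unit vector and its image span an A-invariant plane, and a
  second such pair completes the basis. Here \<rho> is the fibre norm.\<close>

lemma ASD_normal_form:
  assumes "(x, A) \<in> ASD_bundle" "A \<noteq> 0"
  obtains G \<rho> where "orthogonal_matrix G" "\<rho> > 0" "act G (axis 5 1, \<rho> *\<^sub>R std_J) = (x, A)"
proof -
  have A: "transpose A = - A" "A *v x = 0" "hodge x A = - A" and x: "norm x = 1"
    using assms(1) by (auto simp: ASD_bundle_def)
  define c where "c = frob A A / 4"
  have "c > 0"
  proof -
    have "frob A A = A \<bullet> A"
      by (simp add: frob_def inner_vec_def)
    then show ?thesis
      using assms(2) by (simp add: c_def)
  qed
  define \<rho> where "\<rho> = sqrt c"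
  have \<rho>: "\<rho> > 0" "\<rho> * \<rho> = c"
    using \<open>c > 0\<close> by (auto simp: \<rho>_def)
  have sq: "A *v (A *v v) = - c *\<^sub>R v" if "v \<bullet> x = 0" for v
  proof -
    have "A *v (A *v v) = - c *\<^sub>R (proj_tan x *v v)"
      using ASD_square[OF A(1,3) x] by (simp add: matrix_vector_mul_assoc c_def matvec.minus_left matvec.scaleR_left)
    then show ?thesis
      using that by (simp add: proj_tan_eq matvec.diff_left outer_matrix_vector inner_commute)
  qed
  note skw = inner_skew_matrix[OF A(1)]
  obtain f1 where f1: "norm f1 = 1" "f1 \<bullet> x = 0"
    by (rule unit_vector_orthogonal[of "{x}"]) auto
  define f2 where "f2 = (A *v f1) /\<^sub>R \<rho>"
  obtain f3 where f3: "norm f3 = 1" "f3 \<bullet> x = 0" "f3 \<bullet> f1 = 0" "f3 \<bullet> f2 = 0"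
    by (rule unit_vector_orthogonal[of "{x, f1, f2}"]) (auto simp: card_insert_if)
  define f4 where "f4 = (A *v f3) /\<^sub>R \<rho>"
  have Af: "A *v f1 = \<rho> *\<^sub>R f2" "A *v f3 = \<rho> *\<^sub>R f4"
    using \<rho> by (auto simp: f2_def f4_def)
  have Af': "A *v f2 = - \<rho> *\<^sub>R f1" "A *v f4 = - \<rho> *\<^sub>R f3"
    using sq[OF f1(2)] sq[OF f3(2)] \<rho>(1) unfolding \<rho>(2)[symmetric] f2_def f4_def
    by (simp_all add: matvec.scaleR_right)
  have in1: "f1 \<bullet> f1 = 1" "f3 \<bullet> f3 = 1" "x \<bullet> x = 1"
    using f1(1) f3(1) x by (auto simp: norm_eq_1)
  have \<rho>0: "\<rho> \<noteq> 0" using \<rho>(1) by simp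
  have in2: "f1 \<bullet> f2 = 0" "f3 \<bullet> f4 = 0" "f2 \<bullet> x = 0" "f4 \<bullet> x = 0"
    "f2 \<bullet> f2 = 1" "f4 \<bullet> f4 = 1" "f1 \<bullet> f4 = 0" "f2 \<bullet> f4 = 0"
  proof -
    show "f1 \<bullet> f2 = 0" using skw[of f1 f1] \<rho>0 by (simp add: Af inner_commute)
    show "f3 \<bullet> f4 = 0" using skw[of f3 f3] \<rho>0 by (simp add: Af inner_commute)
    show "f2 \<bullet> x = 0" using skw[of f1 x] \<rho>0 by (simp add: Af A(2))
    show "f4 \<bullet> x = 0" using skw[of f3 x] \<rho>0 by (simp add: Af A(2))
    show "f2 \<bullet> f2 = 1" using skw[of f1 f2] \<rho>0 by (simp add: Af Af' in1)
    show "f4 \<bullet> f4 = 1" using skw[of f3 f4] \<rho>0 by (simp add: Af Af' in1)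
    show "f1 \<bullet> f4 = 0" using skw[of f1 f3] \<rho>0 f3(4) by (simp add: Af inner_commute)
    show "f2 \<bullet> f4 = 0" using skw[of f1 f4] \<rho>0 f3(3) by (simp add: Af Af' inner_commute)
  qed
  define F where "F i = (if i = 1 then f1 else if i = 2 then f2 else if i = 3 then f3
      else if i = 4 then f4 else x)" for i :: 5
  define G :: mat5 where "G = (\<chi> r i. F i $ r)"
  have "\<forall>i j. F i \<bullet> F j = (if i = j then 1 else 0)"
    unfolding forall_5 using in1 in2 f1 f3 by (simp add: F_def inner_commute)
  moreover have "(transpose G ** G) $ i $ j = F i \<bullet> F j" for i j
    by (simp add: G_def transpose_def matrix_matrix_mult_def inner_vec_def)
  ultimately have G: "orthogonal_matrix G"
    by (simp add: orthogonal_matrix vec_eq_iff mat_def)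
  have AG: "A ** G = G ** (\<rho> *\<^sub>R std_J)"
  proof -
    have "(A ** G) $ r $ j = (A *v F j) $ r" for r j
      by (simp add: G_def matrix_matrix_mult_def matrix_vector_mult_def)
    moreover have "(G ** (\<rho> *\<^sub>R std_J)) $ r $ j = \<rho> * (\<Sum>i\<in>UNIV. F i $ r * std_J $ i $ j)" for r j
      by (simp add: G_def matrix_matrix_mult_def sum_distrib_left mult_ac)
    moreover have "\<forall>j. (A *v F j) $ r = \<rho> * (\<Sum>i\<in>UNIV. F i $ r * std_J $ i $ j)" for r
      unfolding forall_5 sum_5 by (simp add: F_def std_J_def Af Af' A(2))
    ultimately show ?thesis
      by (simp add: vec_eq_iff)
  qed
  have "act G (axis 5 1, \<rho> *\<^sub>R std_J) = (x, A)"
  proof -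
    have "G *v axis 5 1 = x"
      by (simp add: matrix_vector_mult_basis column_def G_def F_def vec_eq_iff)
    moreover have "G ** (\<rho> *\<^sub>R std_J) ** transpose G = A"
      using G unfolding AG[symmetric] by (simp add: orthogonal_matrix_def flip: matrix_mul_assoc)
    ultimately show ?thesis
      by (simp add: act_def)
  qed
  then show thesis
    using that G \<rho>(1) by blast
qed

text \<open>On the first four coordinates these are the skew matrices anticommuting with
  \<open>std_J\<close>: the tangent plane at \<open>std_J\<close> of the fibre sphere.\<close>

definition vert :: "real \<Rightarrow> real \<Rightarrow> mat5" where
  "vert t s = (\<chi> i j.
     if i = 1 \<and> j = 3 \<or> i = 4 \<and> j = 2 then t
     else if i = 3 \<and> j = 1 \<or> i = 2 \<and> j = 4 then - t
     else if i = 4 \<and> j = 1 \<or> i = 3 \<and> j = 2 then s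
     else if i = 1 \<and> j = 4 \<or> i = 2 \<and> j = 3 then - s else 0)"

text \<open>For skew \<open>X\<close> the second component of \<open>inf_act\<close> is the
  commutator of \<open>X\<close> with the fibre point; within so(4) it sees only the part
  anticommuting with \<open>std_J\<close>.\<close>

lemma vertical_part_std:
  assumes "transpose X = - X"
  shows "proj_tan (axis 5 1) ** snd (inf_act X (axis 5 1, \<rho> *\<^sub>R std_J)) ** proj_tan (axis 5 1)
    = \<rho> *\<^sub>R vert (X$1$4 + X$2$3) (X$1$3 - X$2$4)"
proof -
  have P: "(proj_tan (axis 5 1) ** M ** proj_tan (axis 5 1)) $ i $ j
      = (if i = 5 \<or> j = 5 then 0 else M $ i $ j)" for M i j
  proof -
    have "\<forall>i j. (proj_tan (axis 5 1) ** N) $ i $ j = (if i = 5 then 0 else N $ i $ j)"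
      "\<forall>i j. (N ** proj_tan (axis 5 1)) $ i $ j = (if j = 5 then 0 else N $ i $ j)" for N
      unfolding forall_5
      by (simp_all add: proj_tan_def matrix_matrix_mult_def mat_def axis_def sum_5)
    then show ?thesis by simp
  qed
  have "\<forall>i j. (if i = 5 \<or> j = 5 then 0 else snd (inf_act X (axis 5 1, \<rho> *\<^sub>R std_J)) $ i $ j)
    = \<rho> * vert (X$1$4 + X$2$3) (X$1$3 - X$2$4) $ i $ j"
    unfolding forall_5
    by (simp add: inf_act_def vert_def std_J_def matrix_matrix_mult_def transpose_def sum_5
        skew_entries[OF assms] algebra_simps)
  then show ?thesis
    by (simp add: vec_eq_iff P)
qed

lemma vol_V_vert: "vol_V (\<rho> *\<^sub>R vert t1 s1) (\<rho> *\<^sub>R vert t2 s2) (\<rho> *\<^sub>R vert t3 s3) = 0"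
  by (simp add: vol_V_def frob_def sum_5 vert_def matrix_matrix_mult_def)

text \<open>The vertical parts lie in one plane, so the vertical volume term vanishes and the mixed
  terms remain. The order and signs in the third entry of \<open>tancoord\<close> are chosen so that
  these terms become the real part of a complex determinant.\<close>

lemma phi_std:
  assumes sk: "transpose X = - X" "transpose Y = - Y" "transpose Z = - Z"
    and q: "q = (axis 5 1, \<rho> *\<^sub>R std_J)"
  shows "phi lam q (inf_act X q) (inf_act Y q) (inf_act Z q)
    = 2 * (lam + frob (snd q) (snd q) / 4) powr (1/4) * (\<rho> * Re (det3 (tancoord X) (tancoord Y) (tancoord Z)))"
proof -
  have fst: "fst (inf_act X q) = column 5 X" for X
    by (simp add: inf_act_def q matrix_vector_mult_basis)
  note v = vertical_part_std[OF sk(1), of \<rho>] vertical_part_std[OF sk(2), of \<rho>]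
    vertical_part_std[OF sk(3), of \<rho>]
  have "column 5 Y \<bullet> (\<rho> *\<^sub>R vert (X$1$4 + X$2$3) (X$1$3 - X$2$4) *v column 5 Z)
      - column 5 X \<bullet> (\<rho> *\<^sub>R vert (Y$1$4 + Y$2$3) (Y$1$3 - Y$2$4) *v column 5 Z)
      + column 5 X \<bullet> (\<rho> *\<^sub>R vert (Z$1$4 + Z$2$3) (Z$1$3 - Z$2$4) *v column 5 Y)
    = \<rho> * Re (det3 (tancoord X) (tancoord Y) (tancoord Z))"
    by (simp add: inner_vec_def matrix_vector_mult_def sum_5 column_def vert_def det3_def tancoord_def
        skew_entries[OF sk(1)] skew_entries[OF sk(2)] skew_entries[OF sk(3)])
       (simp add: algebra_simps)
  then show ?thesis
    unfolding phi_def Let_def fst by (simp add: q v vol_V_vert)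
qed

section \<open>Coassociative orbits\<close>

text \<open>On \<open>S\<close> the map \<open>f\<close> factors through \<open>g\<close>, by a
  linear right inverse of \<open>g\<close> with values in \<open>S\<close>. This transfers the
  dimension of the tangent space to the coordinates in which the algebra takes place.\<close>

lemma dim_image_le_of_kernel:
  fixes f :: "'a::euclidean_space \<Rightarrow> 'b::euclidean_space" and g :: "'a \<Rightarrow> 'c::euclidean_space"
  assumes f: "linear f" and g: "linear g" and S: "subspace S"
    and ker: "\<And>x. x \<in> S \<Longrightarrow> g x = 0 \<Longrightarrow> f x = 0"
  shows "dim (f ` S) \<le> dim (g ` S)"
proof -
  obtain h where h: "range h \<subseteq> S" "linear h" "\<forall>v\<in>g ` S. g (h v) = v"
    using real_vector.linear_exists_right_inverse_on[OF g S] by blast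
  have "f x = f (h (g x))" if "x \<in> S" for x
  proof -
    have "x - h (g x) \<in> S"
      using h(1) that S by (intro subspace_diff) auto
    moreover have "g (x - h (g x)) = 0"
      using h(3) that by (simp add: linear_diff[OF g])
    ultimately show ?thesis
      using ker linear_diff[OF f] by fastforce
  qed
  then have "f ` S \<subseteq> (f \<circ> h) ` (g ` S)"
    by force
  then have "dim (f ` S) \<le> dim ((f \<circ> h) ` (g ` S))"
    by (rule dim_subset)
  also have "\<dots> \<le> dim (g ` S)"
    by (rule dim_image_le) (rule linear_compose[OF h(2) f])
  finally show ?thesis .
qed

lemma compact_matrix_group_of_SO5:
  assumes "closed_connected_subgroup_SO5 K"
  shows "compact_matrix_group K"
proof
  have K: "K \<subseteq> SO5" "\<forall>g\<in>K. matrix_inv g \<in> K"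
    using assms by (auto simp: closed_connected_subgroup_SO5_def)
  show "mat 1 \<in> K" "closed K" "\<And>g h. g \<in> K \<Longrightarrow> h \<in> K \<Longrightarrow> g ** h \<in> K"
    using assms by (auto simp: closed_connected_subgroup_SO5_def)
  show orth: "orthogonal_matrix g" if "g \<in> K" for g
    using K(1) that by (auto simp: SO5_def)
  show "transpose g \<in> K" if "g \<in> K" for g
  proof -
    have g: "g ** transpose g = mat 1" "transpose g ** g = mat 1"
      using orth[OF that] by (auto simp: orthogonal_matrix_def)
    then have "g ** matrix_inv g = mat 1"
      unfolding matrix_inv_def by (metis (mono_tags, lifting) someI_ex)
    then have "matrix_inv g = transpose g"
      using matrix_mul_assoc[of "transpose g" g "matrix_inv g"] g(2) by simp
    then show ?thesis
      using K(2) that by metis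
  qed
qed

context
  fixes K :: "mat5 set"
  assumes K: "compact_matrix_group K"
begin

interpretation compact_matrix_group K by (rule K)

lemma coassociative_orbit_fibre_zero:
  assumes lam: "lam > 0" and p: "(x, A) \<in> ASD_bundle"
    and dim: "4 \<le> dim (tangent_vecs (orbit K (x, A)) (x, A))"
    and co: "coassociative lam (orbit K (x, A))"
  shows "A = 0"
proof (rule ccontr)
  assume "A \<noteq> 0"
  then obtain G \<rho> where G: "orthogonal_matrix G" and \<rho>: "\<rho> > 0"
    and act: "act G (axis 5 1, \<rho> *\<^sub>R std_J) = (x, A)"
    using ASD_normal_form[OF p] by blast
  define q where "q = (axis 5 1 :: pt5, \<rho> *\<^sub>R std_J)"
  define conj where "conj X = transpose G ** X ** G" for X
  have lin: "linear conj"
    unfolding conj_def[abs_def]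
    by (rule linearI) (simp_all add: matmul.add_left matmul.add_right matmul.scaleR_left matmul.scaleR_right)
  have G1: "G ** transpose G = mat 1"
    using G by (simp add: orthogonal_matrix_def)
  have inv: "G ** conj X ** transpose G = X" for X
  proof -
    have "G ** conj X ** transpose G = (G ** transpose G) ** X ** (G ** transpose G)"
      by (simp only: conj_def matrix_mul_assoc)
    then show ?thesis by (simp add: G1)
  qed
  have skew: "transpose (conj X) = - conj X" if "X \<in> lie_algebra" for X
    using lie_algebra_skew[OF that]
    by (simp add: conj_def matrix_transpose_mul matrix_mul_assoc matmul.minus_left matmul.minus_right)
  have inf: "inf_act X (x, A) = act G (inf_act (conj X) q)" for X
    using inf_act_conj[OF G, of "conj X" q] by (simp add: inv act q_def)
  have br: "lie_bracket (conj X) (conj Y) = conj (lie_bracket X Y)" for X Y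
    using conj_mult[of "transpose G"] G
    by (simp add: conj_def lie_bracket_def matmul.diff_left matmul.diff_right)
  show False
  proof (rule no_complex_subalgebra)
    show "subspace (conj ` lie_algebra)"
      by (rule linear_subspace_image[OF lin subspace_lie_algebra])
    show "transpose X = - X" if "X \<in> conj ` lie_algebra" for X
      using that skew by blast
    show "lie_bracket X Y \<in> conj ` lie_algebra" if "X \<in> conj ` lie_algebra" "Y \<in> conj ` lie_algebra" for X Y
      using that lie_algebra_bracket by (auto simp: br)
    show "Re (det3 (tancoord X') (tancoord Y') (tancoord Z')) = 0"
      if mem: "X' \<in> conj ` lie_algebra" "Y' \<in> conj ` lie_algebra" "Z' \<in> conj ` lie_algebra" for X' Y' Z'
    proof -
      obtain X Y Z where XYZ: "X \<in> lie_algebra" "Y \<in> lie_algebra" "Z \<in> lie_algebra"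
        "X' = conj X" "Y' = conj Y" "Z' = conj Z"
        using mem by auto
      have "(x, A) \<in> orbit K (x, A)"
        unfolding orbit_def using one_mem act_one by (metis imageI)
      then have "phi lam (x, A) (inf_act X (x, A)) (inf_act Y (x, A)) (inf_act Z (x, A)) = 0"
        using co XYZ inf_act_mem_tangent_vecs[OF K] unfolding coassociative_def by blast
      then have "phi lam q (inf_act X' q) (inf_act Y' q) (inf_act Z' q) = 0"
        using phi_act[OF G, of lam q] act by (simp add: inf XYZ q_def)
      \<comment> \<open>Positivity makes the factor in front of the real part in
        \<open>phi_std\<close> non-zero, so it can be cancelled.\<close>
      moreover have "lam + frob (snd q) (snd q) / 4 > 0"
        using lam by (simp add: frob_def add_pos_nonneg sum_nonneg)
      ultimately show ?thesis
        using phi_std[OF skew[OF XYZ(1)] skew[OF XYZ(2)] skew[OF XYZ(3)] q_def, of lam] \<rho>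
        by (simp add: XYZ)
    qed
    show "4 \<le> dim (tancoord ` conj ` lie_algebra)"
    proof -
      have "dim ((\<lambda>X. inf_act X (x, A)) ` lie_algebra) \<le> dim ((tancoord \<circ> conj) ` lie_algebra)"
      proof (rule dim_image_le_of_kernel)
        show "linear (tancoord \<circ> conj)"
          by (rule linear_compose[OF lin linear_tancoord])
        fix X assume X: "X \<in> lie_algebra" "(tancoord \<circ> conj) X = 0"
        define Y where "Y = conj X"
        note Y = skew_entries[OF skew[OF X(1)], folded Y_def]
        \<comment> \<open>\<open>Y\<close> annihilates \<open>axis 5 1\<close> and its 4x4 block
          commutes with \<open>std_J\<close>; hence it is in the stabiliser of
          \<open>q\<close>.\<close>
        have t0: "Y$1$5 = 0" "Y$2$5 = 0" "Y$3$5 = 0" "Y$4$5 = 0" "Y$1$4 = - Y$2$3" "Y$1$3 = Y$2$4"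
          using X(2) by (auto simp: tancoord_def Y_def zero_prod_def complex_eq_iff)
        have "fst (inf_act Y q) = 0"
          unfolding vec_eq_iff forall_5
          by (simp add: inf_act_def q_def matrix_vector_mult_basis column_def Y t0)
        moreover have "snd (inf_act Y q) = 0"
          unfolding vec_eq_iff forall_5
          by (simp add: inf_act_def q_def matrix_matrix_mult_def transpose_def sum_5 std_J_def Y t0)
        ultimately have "inf_act (conj X) q = 0"
          by (simp add: prod_eq_iff Y_def)
        then show "inf_act X (x, A) = 0"
          by (simp add: inf act_def matmul.zero_left matmul.zero_right zero_prod_def)
      qed (rule linear_inf_act subspace_lie_algebra)+
      then show ?thesis
        using dim by (simp add: tangent_vecs_orbit[OF K] image_comp)
    qed
  qed
qed

lemma four_dim_orbit_zero_section:
  assumes x: "norm x = 1" and dim: "4 \<le> dim (tangent_vecs (orbit K (x, 0)) (x, 0))"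
  shows "orbit K (x, 0) = zero_section"
proof -
  have act0: "act g (x, 0) = (g *v x, 0)" for g
    by (simp add: act_def matmul.zero_left matmul.zero_right)
  have xx: "x \<bullet> x = 1"
    using x by (simp add: norm_eq_1)
  have dimV: "4 \<le> dim ((\<lambda>X. X *v x) ` lie_algebra)"
  proof -
    have "dim ((\<lambda>X. inf_act X (x, 0)) ` lie_algebra) \<le> dim ((\<lambda>X. X *v x) ` lie_algebra)"
    proof (rule dim_image_le_of_kernel)
      show "linear (\<lambda>X. X *v x)"
        by (rule bounded_linear.linear[OF matvec.bounded_linear_left])
      show "inf_act X (x, 0) = 0" if "X *v x = 0" for X
        using that by (simp add: inf_act_def matmul.zero_left matmul.zero_right zero_prod_def)
    qed (rule linear_inf_act subspace_lie_algebra)+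
    then show ?thesis
      using dim by (simp add: tangent_vecs_orbit[OF K])
  qed
  have curve: "((\<lambda>t. h t *v x) has_vector_derivative X *v x) (at 0)"
    if "(h has_vector_derivative X) (at 0)" for h X
    by (rule bounded_linear.has_vector_derivative[OF matvec.bounded_linear_left that])
  have "z \<in> (\<lambda>g. g *v x) ` K" if z: "norm z = 1" for z
  proof -
    \<comment> \<open>On the unit sphere, maximising the inner product with \<open>z\<close> means
      minimising the distance to \<open>z\<close>.\<close>
    have "continuous_on K (\<lambda>g. (g *v x) \<bullet> z)"
      by (intro continuous_on_inner continuous_on_const
          linear_continuous_on matvec.bounded_linear_left)
    then obtain g where g: "g \<in> K" and max: "\<And>h. h \<in> K \<Longrightarrow> (h *v x) \<bullet> z \<le> (g *v x) \<bullet> z"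
      using continuous_attains_sup[OF compact] one_mem by blast
    \<comment> \<open>Moving back by the inverse of \<open>g\<close> puts the maximum at
      \<open>x\<close> itself, where the dimension of the tangent space is known.\<close>
    define y where "y = transpose g *v z"
    have gy: "g *v y = z"
      unfolding y_def matrix_vector_mul_assoc mult_transpose[OF g] by simp
    have y: "norm y = 1"
      unfolding y_def using z norm_orthogonal_matrix_vector[OF orth[OF transpose_mem[OF g]]] by metis
    have max': "(h *v x) \<bullet> y \<le> x \<bullet> y" if "h \<in> K" for h
    proof -
      have "(h *v x) \<bullet> y = ((g ** h) *v x) \<bullet> z"
        unfolding gy[symmetric] matrix_vector_mul_assoc[symmetric]
        by (rule inner_orthogonal_matrix[OF orth[OF g], symmetric])
      also have "\<dots> \<le> (g *v x) \<bullet> z"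
        by (rule max[OF mult_mem[OF g that]])
      also have "\<dots> = x \<bullet> y"
        unfolding gy[symmetric] by (rule inner_orthogonal_matrix[OF orth[OF g]])
      finally show ?thesis .
    qed
    have orth_y: "(X *v x) \<bullet> y = 0" if X: "X \<in> lie_algebra" for X
    proof -
      obtain h where h: "\<And>t::real. h t \<in> K" "h 0 = mat 1" "(h has_vector_derivative X) (at 0)"
        using X by (metis lie_algebraE)
      have "((\<lambda>t. (h t *v x) \<bullet> y) has_real_derivative (X *v x) \<bullet> y) (at 0)"
        unfolding has_real_derivative_iff_has_vector_derivative
        by (rule bounded_linear.has_vector_derivative[OF bounded_linear_inner_left curve[OF h(3)]])
      then show ?thesis
        by (rule DERIV_local_max[of _ _ _ 1]) (auto simp: h max')
    qed
    have "y \<in> span {x}"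
    proof (rule ccontr)
      assume "y \<notin> span {x}"
      then have "independent {y, x}" "card {y, x} = 2"
        using xx by (auto simp: independent_insert span_base card_insert_if)
      then have "dim (span {y, x}) = 2"
        by (simp add: dim_eq_card_independent)
      \<comment> \<open>Tangent vectors are orthogonal to both \<open>x\<close> and
        \<open>y\<close>; if these were independent, only three dimensions would be left for a space
        of dimension at least 4.\<close>
      then have d3: "dim {v \<in> UNIV. \<forall>u\<in>span {y, x}. orthogonal u v} = 3"
        using dim_subspace_orthogonal_to_vectors[of "span {y, x}" "UNIV :: pt5 set"] by simp
      have "orthogonal u (X *v x)" if X: "X \<in> lie_algebra" and u: "u \<in> span {y, x}" for X u
      proof -
        have "(X *v x) \<bullet> x = 0"
          using inner_skew_matrix[OF lie_algebra_skew[OF X], of x x] by (simp add: inner_commute)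
        then have "orthogonal (X *v x) u"
          using orth_y[OF X] by (intro orthogonal_to_span[OF u]) (auto simp: orthogonal_def)
        then show ?thesis
          by (simp add: orthogonal_commute)
      qed
      then have "(\<lambda>X. X *v x) ` lie_algebra \<subseteq> {v \<in> UNIV. \<forall>u\<in>span {y, x}. orthogonal u v}"
        by blast
      from dim_subset[OF this] show False
        unfolding d3 using dimV by simp
    qed
    then obtain c where c: "y = c *\<^sub>R x"
      by (auto simp: span_singleton)
    then have "c = 1 \<or> c = - 1"
      using x y by (auto simp: abs_if split: if_splits)
    \<comment> \<open>For the antipode \<open>y = - x\<close> the maximal inner product would be -1,
      its least possible value, so all of \<open>K\<close> would fix \<open>x\<close> and the
      tangent space would be zero.\<close>
    moreover have "c \<noteq> - 1"
    proof
      assume "c = - 1"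
      then have ge: "(h *v x) \<bullet> x \<ge> 1" if "h \<in> K" for h
        using max'[OF that] c xx by simp
      have fixx: "h *v x = x" if "h \<in> K" for h
      proof -
        have "(h *v x - x) \<bullet> (h *v x - x) = (h *v x) \<bullet> (h *v x) - 2 * ((h *v x) \<bullet> x) + x \<bullet> x"
          by (simp add: inner_diff_left inner_diff_right inner_commute)
        also have "\<dots> \<le> 0"
          using ge[OF that] inner_orthogonal_matrix[OF orth[OF that], of x x] xx by simp
        finally have "(h *v x - x) \<bullet> (h *v x - x) = 0"
          by (rule antisym) simp
        then show ?thesis
          by simp
      qed
      have "X *v x = 0" if X: "X \<in> lie_algebra" for X
      proof -
        obtain h where h: "\<And>t::real. h t \<in> K" "h 0 = mat 1" "(h has_vector_derivative X) (at 0)"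
          using X by (metis lie_algebraE)
        have "((\<lambda>t::real. x) has_vector_derivative X *v x) (at 0)"
          using curve[OF h(3)] by (simp add: fixx h(1))
        then show ?thesis
          by (rule vector_derivative_unique_at) simp
      qed
      then have "(\<lambda>X. X *v x) ` lie_algebra \<subseteq> {0}"
        by auto
      then show False
        using dimV by (simp add: dim_eq_0[THEN iffD2])
    qed
    ultimately show ?thesis
      using c gy g by auto
  qed
  moreover have "norm (g *v x) = 1" if "g \<in> K" for g
    using norm_orthogonal_matrix_vector[OF orth[OF that]] x by simp
  ultimately show ?thesis
    by (auto simp: orbit_def act0 zero_section_def image_iff)
qed

end

theorem theorem1p1:
  fixes lam :: real and K :: "mat5 set" and p :: "pt5 \<times> mat5"
  assumes "lam > 0"
    and "closed_connected_subgroup_SO5 K"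
    and "p \<in> ASD_bundle"
    and "dim (tangent_vecs (orbit K p) p) = 4"
    and "coassociative lam (orbit K p)"
  shows "orbit K p = zero_section"
proof -
  obtain x A where p: "p = (x, A)"
    by fastforce
  have K: "compact_matrix_group K"
    by (rule compact_matrix_group_of_SO5[OF assms(2)])
  have "A = 0"
    using coassociative_orbit_fibre_zero[OF K assms(1)] assms(3-5) by (simp add: p)
  moreover have "norm x = 1"
    using assms(3) by (simp add: p ASD_bundle_def)
  ultimately show ?thesis
    using four_dim_orbit_zero_section[OF K] assms(4) by (simp add: p)
qed

end
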